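(* Let $\lambda\in\partial\mathbb{D}$ be an irrational rotation, let $\phi\in H^\infty(\mathbb{D})$, $\phi\neq0$, and let $T=R_\lambda\phi(B)$ on $H^2(\mathbb{D})$. Suppose there exist a strictly increasing sequence $(n_k)$ of positive integers, a point $z_0\in\mathbb{D}$ and a constant $c>0$ such that $|\Omega_{n_k}(z_0)|>c$ for all $k$, and a point $z_1\in\mathbb{D}$ such that $\Psi_{n_k}(z_1)\to0$ as $k\to\infty$. Then $T$ is hypercyclic.
   Context: $\mathbb{D}$ is the open unit disk, $H^2(\mathbb{D})$ the Hardy space. $B$ is the backward shift: $B1=0$, $Bz^n=z^{n-1}$ for $n\ge1$. $R_\lambda f(z)=f(\lambda z)$. For $\phi\in H^\infty(\mathbb{D})$ write $\overline{\phi}(z):=\overline{\phi(\overline{z})}\in H^\infty(\mathbb{D})$, and let $\phi(B):=M_{\overline{\phi}}^\star$, the adjoint of multiplication by $\overline{\phi}$ on $H^2(\mathbb{D})$ (i.e. $\sum_k c_kB^k$ if $\phi=\sum_k c_kz^k$). "$\lambda$ is an irrational rotation" means $\lambda=e^{2\pi i\theta}$ with $\theta\in\mathbb{R}$ irrational. Put $\alpha=\overline{\lambda}$, $\omega=1/\overline{\lambda}$, and for $n\ge1$, $\Psi_n(z)=\overline{\phi}(z)\overline{\phi}(\alpha z)\cdots\overline{\phi}(\alpha^{n-1}z)$ and $\Omega_n(z)=\overline{\phi}(\omega z)\cdots\overline{\phi}(\omega^nz)$, $z\in\mathbb{D}$. A bounded operator $T$ is hypercyclic if there is a vector $f$ whose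 orbit $\{T^nf:n\in\mathbb{N}\}$ is dense. *)

theory Defs
  imports "HOL-Complex_Analysis.Complex_Analysis"
begin

section \<open>The Hardy space of the unit disc\<close>

definition taylor_coeff :: "(complex \<Rightarrow> complex) \<Rightarrow> nat \<Rightarrow> complex" where
  "taylor_coeff f n = (deriv ^^ n) f 0 / fact n"

text \<open>
  A holomorphic function on the open unit disc is represented by a total function
  that is \<open>0\<close> outside the disc, so that equality of representatives is equality on the disc.
\<close>

definition hardy_functions :: "(complex \<Rightarrow> complex) set" where
  "hardy_functions =
     {f. f holomorphic_on ball 0 1 \<and> (\<forall>z. z \<notin> ball 0 1 \<longrightarrow> f z = 0) \<and>
         summable (\<lambda>n. (cmod (taylor_coeff f n))\<^sup>2)}"

lemma taylor_coeff_zero [simp]: "taylor_coeff (\<lambda>z. 0) n = 0"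
proof -
  have "(deriv ^^ n) (\<lambda>z. 0) = (\<lambda>z. 0 :: complex)"
    by (induction n) auto
  then show ?thesis
    by (simp add: taylor_coeff_def)
qed

lemma taylor_coeff_add:
  assumes "f holomorphic_on ball 0 1" "g holomorphic_on ball 0 1"
  shows "taylor_coeff (\<lambda>z. f z + g z) n = taylor_coeff f n + taylor_coeff g n"
  using higher_deriv_add[OF assms open_ball, of 0 n] by (simp add: taylor_coeff_def add_divide_distrib)

lemma taylor_coeff_cmult:
  assumes "f holomorphic_on ball 0 1"
  shows "taylor_coeff (\<lambda>z. c * f z) n = c * taylor_coeff f n"
  using higher_deriv_cmult[OF assms _ open_ball, of 0 n c] by (simp add: taylor_coeff_def)

lemma summable_cmod_square_add:
  fixes a b :: "nat \<Rightarrow> complex"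
  assumes "summable (\<lambda>n. (cmod (a n))\<^sup>2)" "summable (\<lambda>n. (cmod (b n))\<^sup>2)"
  shows "summable (\<lambda>n. (cmod (a n + b n))\<^sup>2)"
proof (rule summable_comparison_test')
  show "summable (\<lambda>n. 2 * (cmod (a n))\<^sup>2 + 2 * (cmod (b n))\<^sup>2)"
    using assms by (intro summable_add summable_mult)
  fix n
  have "(cmod (a n + b n))\<^sup>2 \<le> (cmod (a n) + cmod (b n))\<^sup>2"
    by (intro power_mono norm_triangle_ineq) auto
  also have "\<dots> \<le> 2 * (cmod (a n))\<^sup>2 + 2 * (cmod (b n))\<^sup>2"
    using sum_squares_bound[of "cmod (a n)" "cmod (b n)"] by (simp add: power2_sum)
  finally show "norm ((cmod (a n + b n))\<^sup>2) \<le> 2 * (cmod (a n))\<^sup>2 + 2 * (cmod (b n))\<^sup>2"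
    by simp
qed

lemma summable_mult_cnj:
  fixes a b :: "nat \<Rightarrow> complex"
  assumes "summable (\<lambda>n. (cmod (a n))\<^sup>2)" "summable (\<lambda>n. (cmod (b n))\<^sup>2)"
  shows "summable (\<lambda>n. a n * cnj (b n))"
proof (rule summable_comparison_test')
  show "summable (\<lambda>n. (cmod (a n))\<^sup>2 + (cmod (b n))\<^sup>2)"
    using assms by (intro summable_add)
  fix n
  have "0 \<le> cmod (a n) * cmod (b n)"
    by simp
  then show "norm (a n * cnj (b n)) \<le> (cmod (a n))\<^sup>2 + (cmod (b n))\<^sup>2"
    using sum_squares_bound[of "cmod (a n)" "cmod (b n)"] by (simp only: norm_mult complex_mod_cnj)
qed

lemma hardy_functions_zero: "(\<lambda>z. 0) \<in> hardy_functions"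
  by (simp add: hardy_functions_def)

lemma hardy_functions_add:
  "f \<in> hardy_functions \<Longrightarrow> g \<in> hardy_functions \<Longrightarrow> (\<lambda>z. f z + g z) \<in> hardy_functions"
  by (auto simp: hardy_functions_def taylor_coeff_add intro: holomorphic_on_add summable_cmod_square_add)

lemma hardy_functions_cmult:
  "f \<in> hardy_functions \<Longrightarrow> (\<lambda>z. c * f z) \<in> hardy_functions"
  by (auto simp: hardy_functions_def taylor_coeff_cmult norm_mult power_mult_distrib
      intro!: holomorphic_intros summable_mult)

typedef hardy = hardy_functions
  morphisms fun_of_hardy Abs_hardy
  using hardy_functions_zero by blast

text \<open>Unspecified when \<open>f\<close> restricted to the disc is not in the Hardy space.\<close>

definition hardy_of :: "(complex \<Rightarrow> complex) \<Rightarrow> hardy" where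
  "hardy_of f = Abs_hardy (\<lambda>z. if z \<in> ball 0 1 then f z else 0)"

definition hcoeff :: "hardy \<Rightarrow> nat \<Rightarrow> complex" where
  "hcoeff f = taylor_coeff (fun_of_hardy f)"

definition hinner :: "hardy \<Rightarrow> hardy \<Rightarrow> complex" where
  "hinner f g = (\<Sum>n. hcoeff f n * cnj (hcoeff g n))"

definition scaleH :: "complex \<Rightarrow> hardy \<Rightarrow> hardy" where
  "scaleH c f = Abs_hardy (\<lambda>z. c * fun_of_hardy f z)"

lemma fun_of_scaleH [simp]: "fun_of_hardy (scaleH c f) z = c * fun_of_hardy f z"
  unfolding scaleH_def using fun_of_hardy[of f] by (simp add: Abs_hardy_inverse hardy_functions_cmult)

lemma hardy_eqI: "(\<And>z. fun_of_hardy f z = fun_of_hardy g z) \<Longrightarrow> f = g"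
  by (simp add: fun_of_hardy_inject[symmetric] fun_eq_iff)

lemma holomorphic_fun_of_hardy: "fun_of_hardy f holomorphic_on ball 0 1"
  using fun_of_hardy[of f] by (simp add: hardy_functions_def)

lemma summable_hcoeff: "summable (\<lambda>n. (cmod (hcoeff f n))\<^sup>2)"
  using fun_of_hardy[of f] by (simp add: hardy_functions_def hcoeff_def)

lemma summable_hinner: "summable (\<lambda>n. hcoeff f n * cnj (hcoeff g n))"
  by (intro summable_mult_cnj summable_hcoeff)

lemma hcoeff_scaleH [simp]: "hcoeff (scaleH c f) n = c * hcoeff f n"
proof -
  have "fun_of_hardy (scaleH c f) = (\<lambda>z. c * fun_of_hardy f z)"
    by auto
  then show ?thesis
    by (simp add: hcoeff_def taylor_coeff_cmult holomorphic_fun_of_hardy)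
qed

instantiation hardy :: real_inner
begin

definition zero_hardy :: hardy where "0 = Abs_hardy (\<lambda>z. 0)"
definition plus_hardy :: "hardy \<Rightarrow> hardy \<Rightarrow> hardy" where
  "f + g = Abs_hardy (\<lambda>z. fun_of_hardy f z + fun_of_hardy g z)"
definition uminus_hardy :: "hardy \<Rightarrow> hardy" where "- f = scaleH (-1) f"
definition minus_hardy :: "hardy \<Rightarrow> hardy \<Rightarrow> hardy" where "f - g = f + (- g)" for f g :: hardy
definition scaleR_hardy :: "real \<Rightarrow> hardy \<Rightarrow> hardy" where "r *\<^sub>R f = scaleH (complex_of_real r) f"
definition inner_hardy :: "hardy \<Rightarrow> hardy \<Rightarrow> real" where "inner f g = Re (hinner f g)"
definition norm_hardy :: "hardy \<Rightarrow> real" where "norm f = sqrt (\<Sum>n. (cmod (hcoeff f n))\<^sup>2)"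
definition sgn_hardy :: "hardy \<Rightarrow> hardy" where "sgn f = inverse (norm f) *\<^sub>R f" for f :: hardy
definition dist_hardy :: "hardy \<Rightarrow> hardy \<Rightarrow> real" where "dist f g = norm (f - g)" for f g :: hardy
definition uniformity_hardy :: "(hardy \<times> hardy) filter" where
  "uniformity_hardy = (INF e\<in>{0 <..}. principal {(x, y). dist x y < e})"
definition open_hardy :: "hardy set \<Rightarrow> bool" where
  "open_hardy U = (\<forall>x\<in>U. eventually (\<lambda>(x', y). x' = x \<longrightarrow> y \<in> U) uniformity)"

lemma fun_of_zero_hardy [simp]: "fun_of_hardy 0 z = 0"
  by (simp add: zero_hardy_def Abs_hardy_inverse hardy_functions_zero)

lemma fun_of_plus_hardy [simp]: "fun_of_hardy (f + g) z = fun_of_hardy f z + fun_of_hardy g z"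
  unfolding plus_hardy_def using fun_of_hardy[of f] fun_of_hardy[of g]
  by (simp add: Abs_hardy_inverse hardy_functions_add)

lemma hcoeff_plus [simp]: "hcoeff (f + g) n = hcoeff f n + hcoeff g n"
proof -
  have "fun_of_hardy (f + g) = (\<lambda>z. fun_of_hardy f z + fun_of_hardy g z)"
    by auto
  then show ?thesis
    by (simp add: hcoeff_def taylor_coeff_add holomorphic_fun_of_hardy)
qed

lemma hcoeff_zero [simp]: "hcoeff 0 n = 0"
proof -
  have "fun_of_hardy 0 = (\<lambda>z. 0)"
    by auto
  then show ?thesis
    by (simp add: hcoeff_def)
qed

lemma hinner_self: "hinner f f = complex_of_real (\<Sum>n. (cmod (hcoeff f n))\<^sup>2)"
  unfolding hinner_def complex_norm_square[symmetric]
  by (rule suminf_of_real[symmetric]) (rule summable_hcoeff)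

lemma hardy_eq_0_iff: "(\<Sum>n. (cmod (hcoeff f n))\<^sup>2) = 0 \<longleftrightarrow> f = 0"
proof
  assume "(\<Sum>n. (cmod (hcoeff f n))\<^sup>2) = 0"
  then have "\<forall>n. hcoeff f n = 0"
    using suminf_eq_zero_iff[OF summable_hcoeff[of f]] by simp
  then have *: "(deriv ^^ n) (fun_of_hardy f) 0 = 0" for n
    by (simp add: hcoeff_def taylor_coeff_def)
  show "f = 0"
  proof (rule hardy_eqI)
    fix z
    show "fun_of_hardy f z = fun_of_hardy 0 z"
    proof (cases "z \<in> ball 0 1")
      case True
      then show ?thesis
        using holomorphic_fun_eq_0_on_ball[OF holomorphic_fun_of_hardy True *] by simp
    next
      case False
      then show ?thesis
        using fun_of_hardy[of f] by (simp add: hardy_functions_def)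
    qed
  qed
qed simp

instance
proof
  fix f g h :: hardy and r s :: real
  show "f + g + h = f + (g + h)" by (rule hardy_eqI) simp
  show "f + g = g + f" by (rule hardy_eqI) simp
  show "0 + f = f" by (rule hardy_eqI) simp
  show "- f + f = 0" by (rule hardy_eqI) (simp add: uminus_hardy_def)
  show "f - g = f + - g" by (simp add: minus_hardy_def)
  show "r *\<^sub>R (f + g) = r *\<^sub>R f + r *\<^sub>R g"
    by (rule hardy_eqI) (simp add: scaleR_hardy_def algebra_simps)
  show "(r + s) *\<^sub>R f = r *\<^sub>R f + s *\<^sub>R f"
    by (rule hardy_eqI) (simp add: scaleR_hardy_def algebra_simps)
  show "r *\<^sub>R s *\<^sub>R f = (r * s) *\<^sub>R f"
    by (rule hardy_eqI) (simp add: scaleR_hardy_def)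
  show "1 *\<^sub>R f = f"
    by (rule hardy_eqI) (simp add: scaleR_hardy_def)
  show "sgn f = inverse (norm f) *\<^sub>R f" by (simp add: sgn_hardy_def)
  show "dist f g = norm (f - g)" by (simp add: dist_hardy_def)
  show "uniformity = (INF e\<in>{0 <..}. principal {(x :: hardy, y). dist x y < e})"
    by (simp add: uniformity_hardy_def)
  show "open U = (\<forall>x\<in>U. \<forall>\<^sub>F (x', y) in uniformity. x' = x \<longrightarrow> y \<in> U)" for U :: "hardy set"
    by (simp add: open_hardy_def)
  have "hinner g f = cnj (hinner f g)"
    unfolding hinner_def using bounded_linear.suminf[OF bounded_linear_cnj summable_hinner[of f g]]
    by (simp add: mult.commute)
  then show "inner f g = inner g f"
    by (simp add: inner_hardy_def)
  show "inner (f + g) h = inner f h + inner g h"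
    unfolding inner_hardy_def hinner_def
    using suminf_add[OF summable_hinner[of f h] summable_hinner[of g h]]
    by (simp add: distrib_right flip: plus_complex.simps)
  show "inner (r *\<^sub>R f) g = r * inner f g"
    unfolding inner_hardy_def hinner_def scaleR_hardy_def
    using suminf_mult[OF summable_hinner[of f g], of "complex_of_real r"]
    by (simp add: mult.assoc)
  show "0 \<le> inner f f"
    by (simp add: inner_hardy_def hinner_self suminf_nonneg summable_hcoeff)
  show "inner f f = 0 \<longleftrightarrow> f = 0"
    by (simp add: inner_hardy_def hinner_self hardy_eq_0_iff)
  show "norm f = sqrt (inner f f)"
    by (simp add: inner_hardy_def hinner_self norm_hardy_def)
qed

end

section \<open>Operators on the Hardy space\<close>

definition bounded_operator :: "(hardy \<Rightarrow> hardy) \<Rightarrow> bool" where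
  "bounded_operator T \<longleftrightarrow> bounded_linear T \<and> (\<forall>c f. T (scaleH c f) = scaleH c (T f))"

definition hypercyclic :: "(hardy \<Rightarrow> hardy) \<Rightarrow> bool" where
  "hypercyclic T \<longleftrightarrow> bounded_operator T \<and> (\<exists>f. closure {(T ^^ n) f |n. True} = UNIV)"

text \<open>Total functions stand for functions on the disc: their values outside are irrelevant.\<close>

definition Hinfty :: "(complex \<Rightarrow> complex) set" where
  "Hinfty = {\<phi>. \<phi> holomorphic_on ball 0 1 \<and> bounded (\<phi> ` ball 0 1)}"

definition conj_fun :: "(complex \<Rightarrow> complex) \<Rightarrow> complex \<Rightarrow> complex" where
  "conj_fun \<phi> z = cnj (\<phi> (cnj z))"

definition mult_op :: "(complex \<Rightarrow> complex) \<Rightarrow> hardy \<Rightarrow> hardy" where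
  "mult_op \<psi> f = hardy_of (\<lambda>z. \<psi> z * fun_of_hardy f z)"

text \<open>Unspecified when \<open>A\<close> has no adjoint with respect to the complex inner product.\<close>

definition hadjoint :: "(hardy \<Rightarrow> hardy) \<Rightarrow> hardy \<Rightarrow> hardy" where
  "hadjoint A = (THE A'. \<forall>f g. hinner (A f) g = hinner f (A' g))"

text \<open>\<open>shift_op \<phi>\<close> is the function \<open>\<phi>(B)\<close> of the backward shift \<open>B\<close>.\<close>

definition shift_op :: "(complex \<Rightarrow> complex) \<Rightarrow> hardy \<Rightarrow> hardy" where
  "shift_op \<phi> = hadjoint (mult_op (conj_fun \<phi>))"

definition rot_op :: "complex \<Rightarrow> hardy \<Rightarrow> hardy" where
  "rot_op lam f = hardy_of (\<lambda>z. fun_of_hardy f (lam * z))"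

definition irrational_rotation :: "complex \<Rightarrow> bool" where
  "irrational_rotation lam \<longleftrightarrow> (\<exists>\<theta>::real. \<theta> \<notin> \<rat> \<and> lam = exp (2 * of_real pi * \<i> * of_real \<theta>))"

definition Psi :: "(complex \<Rightarrow> complex) \<Rightarrow> complex \<Rightarrow> nat \<Rightarrow> complex \<Rightarrow> complex" where
  "Psi \<phi> lam n z = (let \<alpha> = cnj lam in \<Prod>j<n. conj_fun \<phi> (\<alpha> ^ j * z))"

definition Omega :: "(complex \<Rightarrow> complex) \<Rightarrow> complex \<Rightarrow> nat \<Rightarrow> complex \<Rightarrow> complex" where
  "Omega \<phi> lam n z = (let \<omega> = 1 / cnj lam in \<Prod>j=1..n. conj_fun \<phi> (\<omega> ^ j * z))"

end

theory Submission
  imports Defs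
begin

text \<open>
  On reproducing kernels the operator acts by \<open>T k\<^sub>w = cnj (\<psi> w) k\<^sub>v\<close> with \<open>\<psi> = conj_fun \<phi>\<close> and
  \<open>v = cnj lam * w\<close>, so \<open>T\<^sup>n k\<^sub>w\<close> has norm \<open>|\<Psi>\<^sub>n(w)| \<parallel>k\<^sub>w\<parallel>\<close>.
  By Baire's theorem it suffices that \<open>T\<close> is topologically transitive, and for this it suffices that, along a
  common sequence of powers, the orbits of a total set of vectors tend to \<open>0\<close> while the vectors of
  another total set have preimages in a compact set (these need not tend to \<open>0\<close>).

  If \<open>|\<phi>(0)| < 1\<close>, the kernels at points near \<open>0\<close> have orbits tending to \<open>0\<close>, and the lower bound on
  \<open>\<Omega>\<close> bounds the preimages of the kernels at the points \<open>lam\<^sup>j z0\<close>.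
  If \<open>|\<phi>(0)| \<ge> 1\<close>, \<open>T\<close> is upper triangular on polynomials with the distinct diagonal entries
  \<open>\<phi>(0) lam\<^sup>j\<close>, so there is a total set of eigenvectors with eigenvalues of modulus at least \<open>1\<close>,
  while the kernels along a rotation orbit of \<open>z1\<close> tend to \<open>0\<close>.
\<close>

section \<open>Coefficients and completeness\<close>

lemma taylor_coeff_cong:
  assumes "f holomorphic_on ball 0 1" "\<And>z. z \<in> ball 0 1 \<Longrightarrow> f z = g z"
  shows "taylor_coeff f n = taylor_coeff g n"
  unfolding taylor_coeff_def
  using assms by (auto intro!: arg_cong[where f = "\<lambda>x. x / fact n"]
      higher_deriv_transform_within_open[where S = "ball 0 1"] intro: holomorphic_transform)

lemma hardy_of_props:
  assumes "g holomorphic_on ball 0 1" "summable (\<lambda>n. (cmod (taylor_coeff g n))\<^sup>2)"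
  shows fun_of_hardy_of: "z \<in> ball 0 1 \<Longrightarrow> fun_of_hardy (hardy_of g) z = g z"
    and hcoeff_hardy_of: "hcoeff (hardy_of g) = taylor_coeff g"
proof -
  let ?g = "\<lambda>z. if z \<in> ball 0 1 then g z else 0"
  have h: "?g holomorphic_on ball 0 1"
    using assms(1) by (rule holomorphic_transform) simp
  have t: "taylor_coeff ?g n = taylor_coeff g n" for n
    by (rule taylor_coeff_cong[OF h]) simp
  have "?g \<in> hardy_functions"
    using h t assms(2) unfolding hardy_functions_def by auto
  then have *: "fun_of_hardy (hardy_of g) = ?g"
    unfolding hardy_of_def by (rule Abs_hardy_inverse)
  show "z \<in> ball 0 1 \<Longrightarrow> fun_of_hardy (hardy_of g) z = g z"
    by (simp add: *)
  show "hcoeff (hardy_of g) = taylor_coeff g"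
    unfolding hcoeff_def * by (rule ext) (rule t)
qed

lemma fun_of_hardy_outside: "z \<notin> ball 0 1 \<Longrightarrow> fun_of_hardy f z = 0"
  using fun_of_hardy[of f] by (simp add: hardy_functions_def)

lemma fun_of_hardy_sums:
  assumes "z \<in> ball 0 1"
  shows "(\<lambda>n. hcoeff f n * z ^ n) sums fun_of_hardy f z"
  using holomorphic_power_series[OF holomorphic_fun_of_hardy assms, of f]
  by (simp add: hcoeff_def taylor_coeff_def)

lemma hardy_coeff_eqI:
  assumes "\<And>n. hcoeff f n = hcoeff g n"
  shows "f = g"
proof (rule hardy_eqI)
  fix z
  show "fun_of_hardy f z = fun_of_hardy g z"
  proof (cases "z \<in> ball 0 1")
    case True
    then show ?thesis
      using fun_of_hardy_sums[OF True, of f] fun_of_hardy_sums[OF True, of g] assms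
      by (simp add: sums_unique2)
  qed (simp add: fun_of_hardy_outside)
qed

text \<open>Convergence on the whole disc gives \<open>a\<close> radius of convergence at least 1.
  The formal power series with coefficients \<open>a\<close> then evaluates to \<open>f\<close> on
  the disc, and its coefficients are normalised derivatives at 0.\<close>

lemma power_series_on_disc:
  assumes "\<And>z. z \<in> ball 0 1 \<Longrightarrow> (\<lambda>n. a n * z ^ n) sums f z"
  shows holomorphic_power_series_on_disc: "f holomorphic_on ball 0 1"
    and taylor_coeff_power_series: "taylor_coeff f = a"
proof -
  show h: "f holomorphic_on ball 0 1"
    using assms by (intro power_series_holomorphic[of 0 1 a]) simp
  define F where "F = Abs_fps a"
  have "conv_radius a \<ge> 1"
  proof (rule conv_radius_geI_ex')
    fix r :: real assume "0 < r" "ereal r < 1"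
    then show "summable (\<lambda>n. a n * of_real r ^ n)"
      by (intro sums_summable[OF assms]) (simp add: one_ereal_def)
  qed
  then have "fps_conv_radius F > 0"
    using less_le_trans[of 0 1 "fps_conv_radius F"] by (simp add: fps_conv_radius_def F_def)
  then have "fps_nth F n = (deriv ^^ n) (eval_fps F) 0 / fact n" for n
    by (intro fps_nth_fps_expansion eval_fps_has_fps_expansion)
  then have "taylor_coeff (eval_fps F) = fps_nth F"
    by (intro ext) (simp only: taylor_coeff_def)
  then have "taylor_coeff (eval_fps F) = a"
    by (simp add: F_def fun_eq_iff)
  moreover have "taylor_coeff f = taylor_coeff (eval_fps F)"
    by (intro ext taylor_coeff_cong[OF h]) (simp add: eval_fps_def F_def sums_unique[OF assms])
  ultimately show "taylor_coeff f = a"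
    by simp
qed

text \<open>Intended for square-summable \<open>a\<close>, where it inverts
  \<open>hcoeff\<close>.\<close>

definition hardy_series :: "(nat \<Rightarrow> complex) \<Rightarrow> hardy" where
  "hardy_series a = hardy_of (\<lambda>z. \<Sum>n. a n * z ^ n)"

text \<open>Square summability makes \<open>a\<close> bounded, so a geometric series dominates the
  power series in the disc. With \<open>summable_hcoeff\<close> and \<open>hardy_coeff_eqI\<close>
  this identifies the Hardy space with the square-summable sequences.\<close>

lemma hcoeff_hardy_series:
  assumes "summable (\<lambda>n. (cmod (a n))\<^sup>2)"
  shows "hcoeff (hardy_series a) = a"
proof -
  have "(\<lambda>n. (cmod (a n))\<^sup>2) \<longlonglongrightarrow> 0"
    using assms by (rule summable_LIMSEQ_zero)
  then have "a \<longlonglongrightarrow> 0"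
    using tendsto_real_sqrt[of "\<lambda>n. (cmod (a n))\<^sup>2" 0] by (simp add: tendsto_norm_zero_iff)
  then have "Bseq a"
    by (intro convergent_imp_Bseq convergentI)
  then obtain K where K: "\<And>n. norm (a n) \<le> K"
    by (auto simp: Bseq_def)
  have "summable (\<lambda>n. a n * z ^ n)" if "z \<in> ball 0 1" for z
  proof (rule summable_comparison_test')
    show "summable (\<lambda>n. K * norm z ^ n)"
      using that by (intro summable_mult summable_geometric) simp
    show "norm (a n * z ^ n) \<le> K * norm z ^ n" for n
      using K by (simp add: norm_mult norm_power mult_right_mono)
  qed
  then have s: "(\<lambda>n. a n * z ^ n) sums (\<Sum>n. a n * z ^ n)" if "z \<in> ball 0 1" for z
    using that by (simp add: summable_sums)
  show ?thesis
    unfolding hardy_series_def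
    using hcoeff_hardy_of[OF holomorphic_power_series_on_disc[OF s]] taylor_coeff_power_series[OF s] assms
    by simp
qed

lemma hcoeff_uminus [simp]: "hcoeff (- f) n = - hcoeff f n"
  by (simp add: uminus_hardy_def)

lemma hcoeff_diff [simp]: "hcoeff (f - g) n = hcoeff f n - hcoeff g n"
  by (simp only: minus_hardy_def hcoeff_plus hcoeff_uminus diff_conv_add_uminus)

lemma hcoeff_sum [simp]: "hcoeff (sum f A) n = (\<Sum>i\<in>A. hcoeff (f i) n)"
  by (induction A rule: infinite_finite_induct) auto

lemma norm_hardy_sq: "(norm f)\<^sup>2 = (\<Sum>n. (cmod (hcoeff f n))\<^sup>2)"
  by (simp add: norm_hardy_def suminf_nonneg summable_hcoeff)

lemma sum_hcoeff_le_norm: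
  assumes "finite I"
  shows "(\<Sum>n\<in>I. (cmod (hcoeff f n))\<^sup>2) \<le> (norm f)\<^sup>2"
  unfolding norm_hardy_sq using assms by (intro sum_le_suminf summable_hcoeff) auto

lemma cmod_hcoeff_le_norm: "cmod (hcoeff f n) \<le> norm f"
  using sum_hcoeff_le_norm[of "{n}" f] by (simp add: power2_le_iff_abs_le)

lemma norm_hardy_leI:
  assumes "\<And>N. (\<Sum>n<N. (cmod (hcoeff f n))\<^sup>2) \<le> C\<^sup>2" "0 \<le> C"
  shows "norm f \<le> C"
proof -
  have "(norm f)\<^sup>2 \<le> C\<^sup>2"
    unfolding norm_hardy_sq using assms by (intro suminf_le_const summable_hcoeff)
  then show ?thesis
    using assms(2) by (rule power2_le_imp_le)
qed

text \<open>The completeness proof for square-summable sequences: coefficients converge one by one,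
  and the Cauchy bound passes to the limit on finite partial sums.\<close>

lemma complete_hardy: "complete (UNIV :: hardy set)"
proof (rule completeI)
  fix s :: "nat \<Rightarrow> hardy"
  assume c: "Cauchy s"
  have "Cauchy (\<lambda>k. hcoeff (s k) n)" for n
  proof (rule CauchyI)
    fix e :: real assume "e > 0"
    then obtain M where "\<forall>m\<ge>M. \<forall>k\<ge>M. norm (s m - s k) < e"
      using CauchyD[OF c] by blast
    then show "\<exists>M. \<forall>m\<ge>M. \<forall>k\<ge>M. norm (hcoeff (s m) n - hcoeff (s k) n) < e"
      using le_less_trans[OF cmod_hcoeff_le_norm[of "s _ - s _" n]] by (intro exI[of _ M]) simp
  qed
  then have "\<exists>a. (\<lambda>k. hcoeff (s k) n) \<longlonglongrightarrow> a" for n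
    by (simp add: Cauchy_convergent_iff convergent_def)
  then obtain a where a: "\<And>n. (\<lambda>k. hcoeff (s k) n) \<longlonglongrightarrow> a n"
    by metis
  \<comment> \<open>The bound is kept on partial sums, uniformly in \<open>N\<close>, because
    \<open>a\<close> is not yet known to be square summable.\<close>
  have close: "\<exists>M. \<forall>m\<ge>M. \<forall>N. (\<Sum>n<N. (cmod (hcoeff (s m) n - a n))\<^sup>2) \<le> e\<^sup>2"
    if "e > 0" for e :: real
  proof -
    obtain M where M: "\<forall>m\<ge>M. \<forall>k\<ge>M. norm (s m - s k) < e"
      using CauchyD[OF c \<open>e > 0\<close>] by blast
    have "(\<Sum>n<N. (cmod (hcoeff (s m) n - a n))\<^sup>2) \<le> e\<^sup>2" if "m \<ge> M" for m N
    proof (rule tendsto_upperbound)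
      show "(\<lambda>k. \<Sum>n<N. (cmod (hcoeff (s m) n - hcoeff (s k) n))\<^sup>2) \<longlonglongrightarrow>
          (\<Sum>n<N. (cmod (hcoeff (s m) n - a n))\<^sup>2)"
        by (intro tendsto_intros a)
      have "(\<Sum>n<N. (cmod (hcoeff (s m) n - hcoeff (s k) n))\<^sup>2) \<le> e\<^sup>2" if "k \<ge> M" for k
      proof -
        have "(\<Sum>n<N. (cmod (hcoeff (s m) n - hcoeff (s k) n))\<^sup>2) \<le> (norm (s m - s k))\<^sup>2"
          using sum_hcoeff_le_norm[of "{..<N}" "s m - s k"] by simp
        also have "\<dots> \<le> e\<^sup>2"
          using M \<open>m \<ge> M\<close> that by (intro power_mono) (auto intro: less_imp_le)
        finally show ?thesis .
      qed
      then show "\<forall>\<^sub>F k in sequentially.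
          (\<Sum>n<N. (cmod (hcoeff (s m) n - hcoeff (s k) n))\<^sup>2) \<le> e\<^sup>2"
        unfolding eventually_sequentially by blast
    qed simp
    then show ?thesis by blast
  qed
  obtain M where M: "\<And>N. (\<Sum>n<N. (cmod (hcoeff (s M) n - a n))\<^sup>2) \<le> 1\<^sup>2"
    using close[of 1] by auto
  have "summable (\<lambda>n. (cmod (hcoeff (s M) n - a n))\<^sup>2)"
    using M by (intro summableI_nonneg_bounded[where x = "1\<^sup>2"]) simp_all
  \<comment> \<open>The sign is changed so that adding this sequence to the coefficients of
    \<open>s M\<close> leaves exactly \<open>a\<close>.\<close>
  then have "summable (\<lambda>n. (cmod (- (hcoeff (s M) n - a n)))\<^sup>2)"
    by (simp only: norm_minus_cancel)
  from summable_cmod_square_add[OF summable_hcoeff[of "s M"] this]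
  have "summable (\<lambda>n. (cmod (a n))\<^sup>2)"
    by simp
  then obtain f where f: "hcoeff f = a"
    using hcoeff_hardy_series by blast
  have "s \<longlonglongrightarrow> f"
  proof (rule LIMSEQ_I)
    fix e :: real assume "e > 0"
    then obtain M where M: "\<forall>m\<ge>M. \<forall>N. (\<Sum>n<N. (cmod (hcoeff (s m) n - a n))\<^sup>2) \<le> (e/2)\<^sup>2"
      using close[of "e/2"] by auto
    then have "norm (s m - f) \<le> e/2" if "m \<ge> M" for m
      using that \<open>e > 0\<close> f by (intro norm_hardy_leI) auto
    then have "norm (s m - f) < e" if "m \<ge> M" for m
      using that \<open>e > 0\<close> le_less_trans[of "norm (s m - f)" "e/2" e] by simp
    then show "\<exists>M. \<forall>m\<ge>M. norm (s m - f) < e"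
      by blast
  qed
  then show "\<exists>f\<in>UNIV. s \<longlonglongrightarrow> f"
    by blast
qed

text \<open>Puts metric completeness into the form that Baire's theorem for abstract topologies
  takes as hypothesis.\<close>

lemma complete_imp_completely_metrizable_euclidean:
  assumes "complete (UNIV :: 'a::metric_space set)"
  shows "completely_metrizable_space (euclidean :: 'a topology)"
  using Met_TC.completely_metrizable_space_mtopology[where 'a = 'a] assms by simp

section \<open>Multiplication operators and adjoints\<close>

lemma taylor_coeff_mult:
  assumes "f holomorphic_on ball 0 1" "g holomorphic_on ball 0 1"
  shows "taylor_coeff (\<lambda>z. f z * g z) n = (\<Sum>i\<le>n. taylor_coeff f i * taylor_coeff g (n - i))"
proof -
  have "taylor_coeff (\<lambda>z. f z * g z) n =
      (\<Sum>i\<le>n. of_nat (n choose i) * (deriv ^^ i) f 0 * (deriv ^^ (n - i)) g 0 / fact n)"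
    unfolding taylor_coeff_def higher_deriv_mult[OF assms open_ball centre_in_ball[THEN iffD2, OF zero_less_one]]
    by (simp add: sum_divide_distrib atMost_atLeast0)
  also have "\<dots> = (\<Sum>i\<le>n. taylor_coeff f i * taylor_coeff g (n - i))"
    by (intro sum.cong refl) (simp add: taylor_coeff_def binomial_fact)
  finally show ?thesis .
qed

lemma taylor_coeff_polynomial:
  "taylor_coeff (\<lambda>z. \<Sum>i<N. b i * z ^ i) n = (if n < N then b n else 0)"
proof -
  have "(\<lambda>n. (if n < N then b n else 0) * z ^ n) sums (\<Sum>i<N. b i * z ^ i)" for z
    using sums_If_finite_set[of "{..<N}" "\<lambda>n. b n * z ^ n"]
    by (simp add: if_distrib[of "\<lambda>x. x * _"] cong: if_cong)
  from taylor_coeff_power_series[OF this] show ?thesis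
    by (simp add: fun_eq_iff)
qed

text \<open>Cauchy's formula for the derivative of order \<open>n\<close>: the parametrisation
  contributes the factor \<open>2 * pi * \<i> * u\<close>, and \<open>1 / u ^ n\<close> equals
  \<open>cnj u ^ n / r ^ (2 * n)\<close> on the circle of radius \<open>r\<close>.\<close>

lemma circle_mean_taylor_coeff:
  assumes "f holomorphic_on ball 0 1" "0 < r" "r < 1"
  shows "((\<lambda>t. f (circlepath 0 r t) * cnj (circlepath 0 r t) ^ n)
           has_integral (of_real r ^ (2 * n) * taylor_coeff f n)) {0..1}"
proof -
  define u where "u = circlepath 0 r"
  have u: "u t = of_real r * exp (2 * of_real pi * \<i> * of_real t)" for t
    by (simp add: u_def circlepath)
  have vd: "vector_derivative u (at t) = 2 * of_real pi * \<i> * u t" for t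
    using vector_derivative_circlepath[of 0 r t] by (simp add: u_def[symmetric] u mult_ac)
  have u0: "u t \<noteq> 0" for t
    using assms(2) by (simp add: u)
  have nu: "norm (u t) = r" for t
    using assms(2) by (simp add: u norm_mult)
  have uc: "u t * cnj (u t) = (of_real r)\<^sup>2" for t
    using complex_norm_square[of "u t"] by (simp add: nu)
  have "continuous_on (cball 0 r) f" "f holomorphic_on ball 0 r"
    using assms by (auto intro!: holomorphic_on_imp_continuous_on elim!: holomorphic_on_subset)
  from Cauchy_has_contour_integral_higher_derivative_circlepath[OF this, of 0 n]
  have "((\<lambda>t. f (u t) / u t ^ Suc n * (2 * of_real pi * \<i> * u t)) has_integral
      (2 * of_real pi * \<i> * taylor_coeff f n)) {0..1}"
    using assms(2) unfolding has_contour_integral u_def[symmetric] vd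
    by (simp add: taylor_coeff_def)
  from has_integral_mult_right[OF this, of "of_real r ^ (2 * n) / (2 * of_real pi * \<i>)"]
  have "((\<lambda>t. of_real r ^ (2 * n) / (2 * of_real pi * \<i>) * (f (u t) / u t ^ Suc n * (2 * of_real pi * \<i> * u t)))
      has_integral (of_real r ^ (2 * n) / (2 * of_real pi * \<i>) * (2 * of_real pi * \<i> * taylor_coeff f n))) {0..1}" .
  moreover have "of_real r ^ (2 * n) / (2 * of_real pi * \<i>) * (2 * of_real pi * \<i> * taylor_coeff f n) =
      of_real r ^ (2 * n) * taylor_coeff f n"
  proof -
    have *: "x / y * (y * z) = x * z" if "y \<noteq> 0" for x y z :: complex
      using that by simp
    show ?thesis
      by (rule *) simp
  qed
  moreover have "of_real r ^ (2 * n) / (2 * of_real pi * \<i>) * (f (u t) / u t ^ Suc n * (2 * of_real pi * \<i> * u t))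
      = f (u t) * cnj (u t) ^ n" for t
  proof -
    have "of_real r ^ (2 * n) = u t ^ n * cnj (u t) ^ n"
      by (simp only: power_mult uc[of t, symmetric] power_mult_distrib)
    then show ?thesis
      using u0[of t] by (simp add: field_simps)
  qed
  ultimately show ?thesis
    by (simp only: u_def)
qed

text \<open>Integrating \<open>0 \<le> |h - s|\<^sup>2\<close> over the circle, with \<open>s\<close> the Taylor polynomial of \<open>h\<close>, gives Bessel's inequality.\<close>

lemma taylor_coeffs_bound:
  fixes b :: "nat \<Rightarrow> complex" and N :: nat
  defines "p \<equiv> \<lambda>z. \<Sum>i<N. b i * z ^ i"
  assumes h: "h holomorphic_on ball 0 1" and r: "0 < r" "r < 1"
    and bound: "\<And>z. z \<in> ball 0 1 \<Longrightarrow> cmod (h z) \<le> C * cmod (p z)"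
  shows "(\<Sum>n<N. (cmod (taylor_coeff h n))\<^sup>2 * r ^ (2 * n)) \<le> C\<^sup>2 * (\<Sum>n<N. (cmod (b n))\<^sup>2 * r ^ (2 * n))"
proof -
  define u where "u = circlepath 0 r"
  have ub: "u t \<in> ball 0 1" for t
    using r by (simp add: u_def circlepath norm_mult)
  \<comment> \<open>Parseval pairing of \<open>g\<close> with its own Taylor polynomial below degree
    \<open>N\<close>. It is applied to \<open>h\<close>, to \<open>s\<close> and to
    \<open>p\<close>.\<close>
  have pair: "((\<lambda>t. Re (g (u t) * cnj (\<Sum>i<N. d i * u t ^ i))) has_integral
      (\<Sum>n<N. (cmod (d n))\<^sup>2 * r ^ (2 * n))) {0..1}"
    if g: "g holomorphic_on ball 0 1" "\<And>n. n < N \<Longrightarrow> taylor_coeff g n = d n" for g d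
  proof -
    have "((\<lambda>t. \<Sum>n<N. cnj (d n) * (g (u t) * cnj (u t) ^ n)) has_integral
        (\<Sum>n<N. cnj (d n) * (of_real r ^ (2 * n) * taylor_coeff g n))) {0..1}"
      unfolding u_def
      by (intro has_integral_sum has_integral_mult_right circle_mean_taylor_coeff g r) simp
    also have "(\<lambda>t. \<Sum>n<N. cnj (d n) * (g (u t) * cnj (u t) ^ n)) =
        (\<lambda>t. g (u t) * cnj (\<Sum>i<N. d i * u t ^ i))"
      by (simp add: sum_distrib_left mult_ac)
    also have "(\<Sum>n<N. cnj (d n) * (of_real r ^ (2 * n) * taylor_coeff g n)) =
        of_real (\<Sum>n<N. (cmod (d n))\<^sup>2 * r ^ (2 * n))"
      using g(2) by (simp add: complex_norm_square mult_ac del: of_real_power)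
        (simp add: complex_norm_square mult_ac)
    finally show ?thesis
      using has_integral_linear[OF _ bounded_linear_Re, of _ _ "{0..1}"] by (fastforce simp: o_def)
  qed
  define s where "s = (\<lambda>z. \<Sum>i<N. taylor_coeff h i * z ^ i)"
  have hol: "s holomorphic_on ball 0 1" "p holomorphic_on ball 0 1"
    unfolding s_def p_def by (intro holomorphic_intros)+
  have 1: "((\<lambda>t. Re (h (u t) * cnj (s (u t)))) has_integral (\<Sum>n<N. (cmod (taylor_coeff h n))\<^sup>2 * r ^ (2 * n))) {0..1}"
    unfolding s_def by (rule pair[OF h refl])
  have 2: "((\<lambda>t. Re (s (u t) * cnj (s (u t)))) has_integral (\<Sum>n<N. (cmod (taylor_coeff h n))\<^sup>2 * r ^ (2 * n))) {0..1}"
    unfolding s_def using hol(1) by (intro pair) (simp_all add: s_def taylor_coeff_polynomial)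
  have 3: "((\<lambda>t. Re (p (u t) * cnj (p (u t)))) has_integral (\<Sum>n<N. (cmod (b n))\<^sup>2 * r ^ (2 * n))) {0..1}"
    unfolding p_def using hol(2) by (intro pair) (simp_all add: p_def taylor_coeff_polynomial)
  \<comment> \<open>Facts \<open>1\<close> and \<open>2\<close> have the same integral, so the total
    is exactly the right side minus the left side of the claim. By \<open>bound\<close> the
    integrand is at least the square of the modulus of \<open>h - s\<close>.\<close>
  have "((\<lambda>t. C\<^sup>2 * Re (p (u t) * cnj (p (u t))) - 2 * Re (h (u t) * cnj (s (u t))) + Re (s (u t) * cnj (s (u t))))
     has_integral (C\<^sup>2 * (\<Sum>n<N. (cmod (b n))\<^sup>2 * r ^ (2 * n)) - 2 * (\<Sum>n<N. (cmod (taylor_coeff h n))\<^sup>2 * r ^ (2 * n))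
      + (\<Sum>n<N. (cmod (taylor_coeff h n))\<^sup>2 * r ^ (2 * n)))) {0..1}"
    by (intro has_integral_add has_integral_diff has_integral_mult_right 1 2 3)
  moreover have "0 \<le> C\<^sup>2 * Re (p (u t) * cnj (p (u t))) - 2 * Re (h (u t) * cnj (s (u t))) + Re (s (u t) * cnj (s (u t)))" for t
  proof -
    have "(cmod (h (u t)))\<^sup>2 \<le> (C * cmod (p (u t)))\<^sup>2"
      using bound[OF ub] by (intro power_mono) auto
    then have "(cmod (h (u t)))\<^sup>2 \<le> C\<^sup>2 * Re (p (u t) * cnj (p (u t)))"
      by (simp only: power_mult_distrib cmod_power2[of "p (u t)"]) (simp add: power2_eq_square)
    moreover have "0 \<le> (cmod (h (u t) - s (u t)))\<^sup>2"
      by simp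
    then have "0 \<le> (cmod (h (u t)))\<^sup>2 - 2 * Re (h (u t) * cnj (s (u t))) + Re (s (u t) * cnj (s (u t)))"
      unfolding cmod_power2 by (simp add: power2_eq_square algebra_simps)
    ultimately show ?thesis by linarith
  qed
  ultimately have "0 \<le> C\<^sup>2 * (\<Sum>n<N. (cmod (b n))\<^sup>2 * r ^ (2 * n)) - 2 * (\<Sum>n<N. (cmod (taylor_coeff h n))\<^sup>2 * r ^ (2 * n))
      + (\<Sum>n<N. (cmod (taylor_coeff h n))\<^sup>2 * r ^ (2 * n))"
    by (rule has_integral_nonneg)
  then show ?thesis by linarith
qed

lemma taylor_coeff_fun_of_hardy: "taylor_coeff (fun_of_hardy f) = hcoeff f"
  by (simp add: hcoeff_def)

text \<open>The first \<open>N\<close> coefficients of the product depend only on the first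
  \<open>N\<close> coefficients of \<open>f\<close>. So \<open>f\<close> may be replaced by a
  polynomial, to which the estimate on circles applies, and then \<open>r\<close> tends to
  1.\<close>

lemma multiplier_coeffs_bound:
  assumes psi: "\<psi> holomorphic_on ball 0 1" "\<And>z. z \<in> ball 0 1 \<Longrightarrow> cmod (\<psi> z) \<le> C"
  shows "(\<Sum>n<N. (cmod (taylor_coeff (\<lambda>z. \<psi> z * fun_of_hardy f z) n))\<^sup>2) \<le> (C * norm f)\<^sup>2"
proof -
  define p where "p = (\<lambda>z. \<Sum>i<N. hcoeff f i * z ^ i)"
  define c where "c = taylor_coeff (\<lambda>z. \<psi> z * p z)"
  have hol: "(\<lambda>z. \<psi> z * p z) holomorphic_on ball 0 1" "p holomorphic_on ball 0 1"
    unfolding p_def by (intro holomorphic_intros psi)+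
  have c: "taylor_coeff (\<lambda>z. \<psi> z * fun_of_hardy f z) n = c n" if "n < N" for n
    unfolding c_def using that
    by (simp add: taylor_coeff_mult psi holomorphic_fun_of_hardy hol(2) taylor_coeff_fun_of_hardy)
      (auto simp: p_def taylor_coeff_polynomial intro!: sum.cong)
  have le: "(\<Sum>n<N. (cmod (c n))\<^sup>2 * r ^ (2 * n)) \<le> (C * norm f)\<^sup>2" if r: "0 < r" "r < 1" for r
  proof -
    have "(\<Sum>n<N. (cmod (c n))\<^sup>2 * r ^ (2 * n)) \<le> C\<^sup>2 * (\<Sum>n<N. (cmod (hcoeff f n))\<^sup>2 * r ^ (2 * n))"
      unfolding c_def p_def
      by (rule taylor_coeffs_bound[OF hol(1)[unfolded p_def] r])
        (use psi(2) in \<open>auto simp: norm_mult intro!: mult_right_mono\<close>)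
    also have "\<dots> \<le> C\<^sup>2 * (\<Sum>n<N. (cmod (hcoeff f n))\<^sup>2)"
      using r by (intro mult_left_mono sum_mono mult_left_le) (auto simp: power_le_one)
    also have "\<dots> \<le> C\<^sup>2 * (norm f)\<^sup>2"
      by (intro mult_left_mono sum_hcoeff_le_norm) auto
    finally show ?thesis by (simp add: power_mult_distrib)
  qed
  have "((\<lambda>r. \<Sum>n<N. (cmod (c n))\<^sup>2 * r ^ (2 * n)) \<longlongrightarrow> (\<Sum>n<N. (cmod (c n))\<^sup>2 * 1 ^ (2 * n))) (at_left 1)"
    by (intro tendsto_intros)
  then have "(\<Sum>n<N. (cmod (c n))\<^sup>2 * 1 ^ (2 * n)) \<le> (C * norm f)\<^sup>2"
  proof (rule tendsto_upperbound)
    show "\<forall>\<^sub>F r in at_left 1. (\<Sum>n<N. (cmod (c n))\<^sup>2 * r ^ (2 * n)) \<le> (C * norm f)\<^sup>2"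
      using eventually_at_left_real[of 0 1] by (rule eventually_mono[OF _ le]) auto
  qed simp
  then show ?thesis
    using c by simp
qed

lemma bounded_operatorI:
  assumes "\<And>f g. T (f + g) = T f + T g" "\<And>c f. T (scaleH c f) = scaleH c (T f)"
    and "\<And>f. norm (T f) \<le> K * norm f"
  shows "bounded_operator T"
proof -
  have "bounded_linear T"
    by (rule bounded_linear_intro[where K = K])
      (use assms in \<open>simp_all add: scaleR_hardy_def mult.commute\<close>)
  then show ?thesis
    using assms by (simp add: bounded_operator_def)
qed

lemma mult_op_Hinfty:
  assumes "\<psi> \<in> Hinfty"
  shows fun_of_mult_op: "z \<in> ball 0 1 \<Longrightarrow> fun_of_hardy (mult_op \<psi> f) z = \<psi> z * fun_of_hardy f z"
    and hcoeff_mult_op: "hcoeff (mult_op \<psi> f) n = (\<Sum>i\<le>n. taylor_coeff \<psi> i * hcoeff f (n - i))"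
    and bounded_operator_mult_op: "bounded_operator (mult_op \<psi>)"
proof -
  have psi: "\<psi> holomorphic_on ball 0 1"
    using assms by (simp add: Hinfty_def)
  obtain C where C: "\<And>z. z \<in> ball 0 1 \<Longrightarrow> cmod (\<psi> z) \<le> C" "C > 0"
  proof -
    from assms obtain b where "b > 0" "\<forall>x\<in>\<psi> ` ball 0 1. norm x \<le> b"
      by (auto simp: Hinfty_def bounded_pos)
    then show thesis
      by (intro that[of b]) blast+
  qed
  note bound = multiplier_coeffs_bound[OF psi C(1)]
  have hol: "(\<lambda>z. \<psi> z * fun_of_hardy f z) holomorphic_on ball 0 1" for f
    by (intro holomorphic_intros psi holomorphic_fun_of_hardy)
  have s: "summable (\<lambda>n. (cmod (taylor_coeff (\<lambda>z. \<psi> z * fun_of_hardy f z) n))\<^sup>2)" for f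
    using bound[of f] by (intro summableI_nonneg_bounded[where x = "(C * norm f)\<^sup>2"]) auto
  show f: "z \<in> ball 0 1 \<Longrightarrow> fun_of_hardy (mult_op \<psi> f) z = \<psi> z * fun_of_hardy f z" for z f
    unfolding mult_op_def by (rule fun_of_hardy_of[OF hol s])
  have c: "hcoeff (mult_op \<psi> f) = taylor_coeff (\<lambda>z. \<psi> z * fun_of_hardy f z)" for f
    unfolding mult_op_def by (rule hcoeff_hardy_of[OF hol s])
  then show c': "hcoeff (mult_op \<psi> f) n = (\<Sum>i\<le>n. taylor_coeff \<psi> i * hcoeff f (n - i))" for f n
    by (simp add: taylor_coeff_mult[OF psi holomorphic_fun_of_hardy] taylor_coeff_fun_of_hardy)
  show "bounded_operator (mult_op \<psi>)"
  proof (rule bounded_operatorI)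
    show "norm (mult_op \<psi> f) \<le> C * norm f" for f
      using bound[of f] C(2) by (intro norm_hardy_leI) (simp_all add: c)
  qed (auto intro!: hardy_coeff_eqI simp: c' sum.distrib sum_distrib_left algebra_simps)
qed

section \<open>The complex inner product and its relation to the real one\<close>

lemma hinner_commute: "hinner g f = cnj (hinner f g)"
  unfolding hinner_def using bounded_linear.suminf[OF bounded_linear_cnj summable_hinner[of f g]]
  by (simp add: mult.commute)

lemma hinner_add_left: "hinner (f + g) h = hinner f h + hinner g h"
  unfolding hinner_def using suminf_add[OF summable_hinner[of f h] summable_hinner[of g h]]
  by (simp add: distrib_right)

lemma hinner_scaleH_left: "hinner (scaleH c f) g = c * hinner f g"
  unfolding hinner_def using suminf_mult[OF summable_hinner[of f g], of c] by (simp add: mult.assoc)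

lemma hinner_add_right: "hinner f (g + h) = hinner f g + hinner f h"
  by (simp add: hinner_commute[of f] hinner_add_left)

lemma hinner_scaleH_right: "hinner f (scaleH c g) = cnj c * hinner f g"
  by (simp add: hinner_commute[of f] hinner_scaleH_left)

lemma hinner_zero_left [simp]: "hinner 0 g = 0"
  using hinner_scaleH_left[of 0 0 g] by (simp add: hinner_def)

lemma hinner_sum_left: "hinner (sum f A) g = (\<Sum>i\<in>A. hinner (f i) g)"
  by (induction A rule: infinite_finite_induct) (auto simp: hinner_add_left)

lemma norm_scaleH [simp]: "norm (scaleH c f) = cmod c * norm f"
proof (rule power2_eq_imp_eq)
  show "(norm (scaleH c f))\<^sup>2 = (cmod c * norm f)\<^sup>2"
    using suminf_mult[OF summable_hcoeff[of f], of "(cmod c)\<^sup>2"]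
    by (simp add: norm_hardy_sq norm_mult power_mult_distrib)
qed auto

lemma hinner_conv_inner: "hinner f g = Complex (inner f g) (inner f (scaleH \<i> g))"
  by (simp add: complex_eq_iff inner_hardy_def hinner_scaleH_right)

text \<open>The factor 2 comes from bounding real and imaginary parts separately; the estimate
  serves only to show continuity.\<close>

lemma cmod_hinner_le: "cmod (hinner f g) \<le> 2 * norm f * norm g"
proof -
  have "cmod (hinner f g) \<le> \<bar>inner f g\<bar> + \<bar>inner f (scaleH \<i> g)\<bar>"
    using cmod_le[of "hinner f g"] by (simp add: hinner_conv_inner)
  also have "\<dots> \<le> norm f * norm g + norm f * norm (scaleH \<i> g)"
    by (intro add_mono Cauchy_Schwarz_ineq2)
  finally show ?thesis by simp
qed

lemma bounded_linear_hinner_left: "bounded_linear (\<lambda>f. hinner f g)"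
proof (rule bounded_linear_intro[where K = "2 * norm g"])
  show "norm (hinner f g) \<le> norm f * (2 * norm g)" for f
    using cmod_hinner_le[of f g] by (simp add: mult_ac)
qed (simp_all add: hinner_add_left scaleR_hardy_def hinner_scaleH_left scaleR_conv_of_real)

section \<open>Monomials and density of polynomials\<close>

definition monomial :: "nat \<Rightarrow> hardy" where
  "monomial i = hardy_series (\<lambda>n. if n = i then 1 else 0)"

lemma hcoeff_monomial: "hcoeff (monomial i) n = (if n = i then 1 else 0)"
proof -
  have "summable (\<lambda>n. (cmod (if n = i then 1 else 0))\<^sup>2)"
    by (rule summable_finite[of "{i}"]) auto
  then show ?thesis
    by (simp add: monomial_def hcoeff_hardy_series)
qed

lemma hinner_monomial_right: "hinner f (monomial i) = hcoeff f i"
proof -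
  have "(\<lambda>n. hcoeff f n * cnj (hcoeff (monomial i) n)) sums
      (\<Sum>n\<in>{i}. hcoeff f n * cnj (hcoeff (monomial i) n))"
    by (rule sums_finite) (auto simp: hcoeff_monomial)
  then show ?thesis
    by (simp add: hinner_def hcoeff_monomial sums_iff)
qed

lemma hinner_monomial_left: "hinner (monomial i) f = cnj (hcoeff f i)"
  by (subst hinner_commute) (simp add: hinner_monomial_right)

lemma hinner_eqI: "(\<And>f. hinner f g = hinner f h) \<Longrightarrow> g = h"
  by (rule hardy_coeff_eqI) (metis hinner_monomial_left complex_cnj_cnj)

definition hardy_poly :: "nat \<Rightarrow> (nat \<Rightarrow> complex) \<Rightarrow> hardy" where
  "hardy_poly N a = (\<Sum>i<N. scaleH (a i) (monomial i))"

lemma hcoeff_hardy_poly: "hcoeff (hardy_poly N a) n = (if n < N then a n else 0)"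
  by (simp add: hardy_poly_def hcoeff_monomial if_distrib[of "\<lambda>x. _ * x"] cong: if_cong)

lemma norm_hardy_poly_sq: "(norm (hardy_poly N a))\<^sup>2 = (\<Sum>i<N. (cmod (a i))\<^sup>2)"
proof -
  have "(\<lambda>n. (cmod (hcoeff (hardy_poly N a) n))\<^sup>2) sums (\<Sum>i<N. (cmod (hcoeff (hardy_poly N a) i))\<^sup>2)"
    by (rule sums_finite) (auto simp: hcoeff_hardy_poly)
  then show ?thesis
    by (simp add: norm_hardy_sq sums_iff hcoeff_hardy_poly)
qed

lemma hardy_poly_tendsto: "(\<lambda>N. hardy_poly N (hcoeff f)) \<longlonglongrightarrow> f"
proof -
  have eq: "(norm (f - hardy_poly N (hcoeff f)))\<^sup>2 = (\<Sum>n. (cmod (hcoeff f (n + N)))\<^sup>2)" for N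
  proof -
    have s: "summable (\<lambda>n. (cmod (hcoeff (f - hardy_poly N (hcoeff f)) n))\<^sup>2)"
      by (rule summable_hcoeff)
    show ?thesis
      unfolding norm_hardy_sq suminf_split_initial_segment[OF s, of N]
      by (simp add: hcoeff_hardy_poly)
  qed
  have "(\<lambda>N. \<Sum>n. (cmod (hcoeff f (n + N)))\<^sup>2) \<longlonglongrightarrow> 0"
    by (rule suminf_exist_split2[OF summable_hcoeff])
  then have "(\<lambda>N. (norm (f - hardy_poly N (hcoeff f)))\<^sup>2) \<longlonglongrightarrow> 0"
    by (simp only: eq)
  from tendsto_real_sqrt[OF this] have "(\<lambda>N. norm (f - hardy_poly N (hcoeff f))) \<longlonglongrightarrow> 0"
    by simp
  then have "(\<lambda>N. norm (hardy_poly N (hcoeff f) - f)) \<longlonglongrightarrow> 0"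
    by (simp only: norm_minus_commute)
  then show ?thesis
    by (simp add: tendsto_norm_zero_iff Lim_null[of _ f])
qed

section \<open>Adjoints of bounded operators\<close>

lemma bounded_operatorD:
  assumes "bounded_operator T"
  shows "bounded_linear T" "T (scaleH c f) = scaleH c (T f)" "T (f + g) = T f + T g"
    and "T (sum h A) = (\<Sum>i\<in>A. T (h i))"
  using assms by (auto simp: bounded_operator_def linear_simps linear_sum bounded_linear.linear)

text \<open>Riesz representation in coordinates: testing against monomials forces the coefficients
  of \<open>A' g\<close> to be \<open>d\<close>. Once \<open>d\<close> is square summable, the
  identity extends from polynomials to all \<open>f\<close> by continuity.\<close>

lemma adjoint_exists:
  assumes A: "bounded_operator A"
  shows "\<exists>A'. \<forall>f g. hinner (A f) g = hinner f (A' g)"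
proof -
  obtain K where K: "\<And>f. norm (A f) \<le> norm f * K" and K0: "K > 0"
    using bounded_linear.pos_bounded[OF bounded_operatorD(1)[OF A]] by blast
  have "\<exists>x. \<forall>f. hinner (A f) g = hinner f x" for g
  proof -
    define d where "d n = cnj (hinner (A (monomial n)) g)" for n
    have poly: "hinner (A (hardy_poly N a)) g = (\<Sum>n<N. a n * cnj (d n))" for N a
      by (simp add: hardy_poly_def bounded_operatorD[OF A] hinner_sum_left hinner_scaleH_left d_def)
    have "(\<Sum>n<N. (cmod (d n))\<^sup>2) \<le> (K * norm g)\<^sup>2" for N
    proof -
      \<comment> \<open>Testing with the polynomial whose coefficients are \<open>d\<close> itself
        turns the pairing into the squared norm of \<open>p\<close>; cancelling one factor
        \<open>norm p\<close> bounds the partial sums.\<close>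
      define p where "p = hardy_poly N d"
      have "complex_of_real ((norm p)\<^sup>2) = hinner (A p) g"
        unfolding p_def poly norm_hardy_poly_sq by (simp add: complex_norm_square[symmetric])
      then have "(norm p)\<^sup>2 = inner (A p) g"
        unfolding inner_hardy_def by (metis Re_complex_of_real)
      also have "\<dots> \<le> norm (A p) * norm g"
        by (rule norm_cauchy_schwarz)
      also have "\<dots> \<le> norm p * (K * norm g)"
        using mult_right_mono[OF K[of p], of "norm g"] by (simp add: mult_ac)
      finally have "norm p \<le> K * norm g"
        using K0 by (cases "p = 0") (simp_all add: power2_eq_square)
      then have "(norm p)\<^sup>2 \<le> (K * norm g)\<^sup>2"
        by (rule power_mono) simp
      then show ?thesis
        by (simp add: p_def norm_hardy_poly_sq)
    qed
    then have "summable (\<lambda>n. (cmod (d n))\<^sup>2)"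
      by (intro summableI_nonneg_bounded[where x = "(K * norm g)\<^sup>2"]) simp_all
    then obtain x where x: "hcoeff x = d"
      using hcoeff_hardy_series by blast
    have "hinner (A f) g = hinner f x" for f
    proof -
      have "(\<lambda>N. hinner (A (hardy_poly N (hcoeff f))) g) \<longlonglongrightarrow> hinner (A f) g"
        by (intro bounded_linear.tendsto[OF bounded_linear_hinner_left]
            bounded_linear.tendsto[OF bounded_operatorD(1)[OF A]] hardy_poly_tendsto)
      moreover have "(\<lambda>N. hinner (A (hardy_poly N (hcoeff f))) g) \<longlonglongrightarrow> hinner f x"
        unfolding poly using summable_LIMSEQ[OF summable_hinner[of f x]] by (simp add: hinner_def x)
      ultimately show ?thesis
        by (rule LIMSEQ_unique)
    qed
    then show ?thesis by blast
  qed
  then show ?thesis by metis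
qed

text \<open>Existence together with uniqueness of the adjoint makes the definite description in
  \<open>hadjoint\<close> meaningful.\<close>

lemma hinner_hadjoint:
  assumes "bounded_operator A"
  shows "hinner (A f) g = hinner f (hadjoint A g)"
proof -
  have "\<exists>!A'. \<forall>f g. hinner (A f) g = hinner f (A' g)"
    using adjoint_exists[OF assms] by (metis ext hinner_eqI)
  then have "\<forall>f g. hinner (A f) g = hinner f (hadjoint A g)"
    unfolding hadjoint_def by (rule theI')
  then show ?thesis by blast
qed

lemma bounded_operator_hadjoint:
  assumes A: "bounded_operator A"
  shows "bounded_operator (hadjoint A)"
proof -
  obtain K where K: "\<And>f. norm (A f) \<le> norm f * K" and K0: "K > 0"
    using bounded_linear.pos_bounded[OF bounded_operatorD(1)[OF A]] by blast
  note adj = hinner_hadjoint[OF A, symmetric]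
  show ?thesis
  proof (rule bounded_operatorI)
    show "hadjoint A (f + g) = hadjoint A f + hadjoint A g" for f g
      by (rule hinner_eqI) (simp add: adj hinner_add_right)
    show "hadjoint A (scaleH c f) = scaleH c (hadjoint A f)" for c f
      by (rule hinner_eqI) (simp add: adj hinner_scaleH_right)
    show "norm (hadjoint A f) \<le> K * norm f" for f
    proof -
      let ?p = "hadjoint A f"
      have "(norm ?p)\<^sup>2 = inner (A ?p) f"
        by (simp add: power2_norm_eq_inner inner_hardy_def adj)
      also have "\<dots> \<le> norm (A ?p) * norm f"
        by (rule norm_cauchy_schwarz)
      also have "\<dots> \<le> norm ?p * (K * norm f)"
        using mult_right_mono[OF K[of ?p], of "norm f"] by (simp add: mult_ac)
      finally show ?thesis
        using K0 by (cases "?p = 0") (simp_all add: power2_eq_square)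
    qed
  qed
qed

section \<open>Density and topological transitivity\<close>

text \<open>Parallelogram law: the midpoint of two points of \<open>S\<close> lies in
  \<open>S\<close>, hence at distance at least \<open>d\<close> from \<open>f\<close>. Two points
  that almost attain the distance are therefore close to each other.\<close>

lemma nearest_sequence_Cauchy:
  fixes S :: "'a::real_inner set"
  assumes S: "subspace S" and s: "\<And>n. s n \<in> S" "(\<lambda>n. norm (f - s n)) \<longlonglongrightarrow> infdist f S"
  shows "Cauchy s"
proof -
  define d where "d = infdist f S"
  have d: "d \<le> norm (f - x)" "0 \<le> d" if "x \<in> S" for x
    using that infdist_le[of x S f] by (auto simp: d_def dist_norm infdist_nonneg)
  have par: "(norm (x - y))\<^sup>2 \<le> 2 * ((norm (f - x))\<^sup>2 - d\<^sup>2) + 2 * ((norm (f - y))\<^sup>2 - d\<^sup>2)"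
    if "x \<in> S" "y \<in> S" for x y
  proof -
    have m: "(1/2) *\<^sub>R (x + y) \<in> S"
      using that S by (simp add: subspace_add subspace_scale)
    have "d\<^sup>2 \<le> (norm (f - (1/2) *\<^sub>R (x + y)))\<^sup>2"
      using d[OF m] by (intro power_mono)
    moreover have "(norm (x - y))\<^sup>2 = 2 * (norm (f - x))\<^sup>2 + 2 * (norm (f - y))\<^sup>2 -
        4 * (norm (f - (1/2) *\<^sub>R (x + y)))\<^sup>2"
    proof -
      define a b where "a = f - x" and "b = f - y"
      have xy: "x - y = b - a"
        by (simp add: a_def b_def)
      have "f - (1/2) *\<^sub>R (x + y) = (1/2) *\<^sub>R (a + b) + (f - (1/2) *\<^sub>R (f + f))"
        unfolding a_def b_def by (simp only: scaleR_right_distrib scaleR_right_diff_distrib) simp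
      moreover have "(1/2) *\<^sub>R (f + f) = f"
        by (rule scaleR_half_double)
      ultimately have mid: "f - (1/2) *\<^sub>R (x + y) = (1/2) *\<^sub>R (a + b)"
        by (simp only: diff_self add_0_right)
      have "(norm (b - a))\<^sup>2 + (norm (a + b))\<^sup>2 = 2 * (norm a)\<^sup>2 + 2 * (norm b)\<^sup>2"
        unfolding power2_norm_eq_inner
        by (simp add: inner_diff_left inner_diff_right inner_add_left inner_add_right inner_commute)
      moreover have "4 * (norm ((1/2) *\<^sub>R (a + b)))\<^sup>2 = (norm (a + b))\<^sup>2"
        by (simp add: power_divide)
      ultimately show ?thesis
        unfolding xy mid by (simp add: a_def b_def)
    qed
    ultimately show ?thesis by simp
  qed
  have lim: "(\<lambda>n. (norm (f - s n))\<^sup>2 - d\<^sup>2) \<longlonglongrightarrow> 0"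
    using tendsto_diff[OF tendsto_power[OF s(2), of 2] tendsto_const[of "d\<^sup>2"]] by (simp add: d_def)
  show ?thesis
  proof (rule CauchyI)
    fix e :: real assume "e > 0"
    then obtain M where M: "\<And>n. n \<ge> M \<Longrightarrow> \<bar>(norm (f - s n))\<^sup>2 - d\<^sup>2\<bar> < e\<^sup>2 / 4"
      using LIMSEQ_D[OF lim, of "e\<^sup>2 / 4"] by auto
    have "norm (s m - s n) < e" if "m \<ge> M" "n \<ge> M" for m n
    proof -
      have "(norm (s m - s n))\<^sup>2 < e\<^sup>2"
      proof -
        have "u < q" if "u \<le> 2 * v + 2 * w" "v < q / 4" "w < q / 4" for q u v w :: real
          using that by linarith
        from this[OF par[OF s(1) s(1)] le_less_trans[OF abs_ge_self M[OF that(1)]]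
            le_less_trans[OF abs_ge_self M[OF that(2)]]] show ?thesis .
      qed
      then show ?thesis
        by (rule power2_less_imp_less) (use \<open>e > 0\<close> in simp)
    qed
    then show "\<exists>M. \<forall>m\<ge>M. \<forall>n\<ge>M. norm (s m - s n) < e"
      by blast
  qed
qed

text \<open>Orthogonal projection onto the closure of \<open>S\<close>: a minimising sequence in
  \<open>S\<close> converges to some \<open>p\<close>, the difference \<open>f - p\<close> is
  orthogonal to \<open>S\<close>, and so \<open>f = p\<close> is a limit of points of
  \<open>S\<close>.\<close>

lemma dense_subspaceI:
  fixes S :: "'a::real_inner set"
  assumes complete: "complete (UNIV :: 'a set)" and S: "subspace S"
    and orth: "\<And>g. (\<And>s. s \<in> S \<Longrightarrow> inner s g = 0) \<Longrightarrow> g = 0"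
  shows "closure S = UNIV"
proof -
  have "f \<in> closure S" for f
  proof -
    have ne: "S \<noteq> {}"
      using subspace_0[OF S] by blast
    have "\<exists>x\<in>S. norm (f - x) < infdist f S + inverse (Suc n)" for n
    proof (rule ccontr)
      assume "\<not> ?thesis"
      then have "infdist f S + inverse (Suc n) \<le> infdist f S"
        using ne by (subst (2) infdist_notempty) (auto intro!: cINF_greatest simp: dist_norm not_less)
      then show False by simp
    qed
    then obtain s where s: "\<And>n. s n \<in> S" "\<And>n. norm (f - s n) < infdist f S + inverse (Suc n)"
      by metis
    have low: "infdist f S \<le> norm (f - x)" if "x \<in> S" for x
      using infdist_le[OF that, of f] by (simp add: dist_norm)
    have "(\<lambda>n. infdist f S + inverse (real (Suc n))) \<longlonglongrightarrow> infdist f S + 0"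
      by (intro tendsto_intros LIMSEQ_inverse_real_of_nat)
    then have up: "(\<lambda>n. infdist f S + inverse (real (Suc n))) \<longlonglongrightarrow> infdist f S"
      by simp
    have lim: "(\<lambda>n. norm (f - s n)) \<longlonglongrightarrow> infdist f S"
    proof (rule tendsto_sandwich[OF _ _ tendsto_const up])
      show "\<forall>\<^sub>F n in sequentially. infdist f S \<le> norm (f - s n)"
        using low[OF s(1)] by simp
      show "\<forall>\<^sub>F n in sequentially. norm (f - s n) \<le> infdist f S + inverse (real (Suc n))"
        using s(2) by (intro always_eventually allI less_imp_le)
    qed
    obtain p where p: "s \<longlonglongrightarrow> p"
      using complete nearest_sequence_Cauchy[OF S s(1) lim] by (auto simp: complete_def)
    then have "(\<lambda>n. norm (f - s n)) \<longlonglongrightarrow> norm (f - p)"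
      by (intro tendsto_intros)
    then have np: "norm (f - p) = infdist f S"
      using lim by (rule LIMSEQ_unique)
    \<comment> \<open>The limit \<open>p\<close> may lie outside \<open>S\<close>, so minimality is
      derived for \<open>s n + x\<close>, which is in \<open>S\<close>, and then passed to the
      limit.\<close>
    have away: "norm (f - p) \<le> norm (f - p - x)" if "x \<in> S" for x
    proof (rule tendsto_lowerbound)
      show "(\<lambda>n. norm (f - s n - x)) \<longlonglongrightarrow> norm (f - p - x)"
        by (intro tendsto_intros p)
      show "\<forall>\<^sub>F n in sequentially. norm (f - p) \<le> norm (f - s n - x)"
        using low[OF subspace_add[OF S s(1) that]] by (simp add: np diff_diff_eq)
    qed simp
    have "inner x (f - p) = 0" if "x \<in> S" for x
    proof (rule ccontr)
      assume nz: "inner x (f - p) \<noteq> 0"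
      then have x: "inner x x > 0" by auto
      \<comment> \<open>This \<open>t\<close> minimises the norm of
        \<open>f - p - t *\<^sub>R x\<close>; a nonzero inner product would make the minimum smaller
        than \<open>norm (f - p)\<close>.\<close>
      define t where "t = inner x (f - p) / inner x x"
      have "norm (f - p) \<le> norm (f - p - t *\<^sub>R x)"
        by (intro away subspace_scale[OF S that])
      then have "(norm (f - p))\<^sup>2 \<le> (norm (f - p - t *\<^sub>R x))\<^sup>2"
        by (rule power_mono) simp
      also have "\<dots> = (norm (f - p))\<^sup>2 - 2 * t * inner x (f - p) + t * (t * inner x x)"
        unfolding power2_norm_eq_inner[of "f - p - _"] power2_norm_eq_inner[of "f - p"]
        by (simp add: inner_diff_left[of "f - p" "t *\<^sub>R x"] inner_diff_right[of _ "f - p" "t *\<^sub>R x"]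
            inner_commute[of "f - p" x] right_diff_distrib)
      also have "t * inner x x = inner x (f - p)"
        using x by (simp add: t_def)
      finally have "t * inner x (f - p) \<le> 0" by simp
      then have "inner x (f - p) * inner x (f - p) / inner x x \<le> 0"
        by (simp add: t_def)
      then show False
        using x nz by (auto simp: divide_le_0_iff mult_le_0_iff)
    qed
    then have "f - p = 0"
      by (rule orth)
    then show ?thesis
      using p s(1) by (auto simp: closure_sequential)
  qed
  then show ?thesis by blast
qed

text \<open>For a complex subspace, real orthogonality is complex orthogonality:
  \<open>scaleH (- \<i>) s\<close> is again in \<open>S\<close>, and its real inner product with
  \<open>g\<close> is the imaginary part of \<open>hinner s g\<close>.\<close>

lemma dense_complex_subspaceI:
  fixes S :: "hardy set"
  assumes "0 \<in> S" "\<And>x y. x \<in> S \<Longrightarrow> y \<in> S \<Longrightarrow> x + y \<in> S" "\<And>c x. x \<in> S \<Longrightarrow> scaleH c x \<in> S"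
    and orth: "\<And>g. (\<And>s. s \<in> S \<Longrightarrow> hinner s g = 0) \<Longrightarrow> g = 0"
  shows "closure S = UNIV"
proof (rule dense_subspaceI[OF complete_hardy])
  show "subspace S"
    using assms by (simp add: subspace_def scaleR_hardy_def)
  fix g
  assume *: "inner s g = 0" if "s \<in> S" for s
  have "hinner s g = 0" if "s \<in> S" for s
  proof -
    have "inner (scaleH (- \<i>) s) g = 0"
      using that assms(3) by (intro *)
    then show ?thesis
      using *[OF that] by (simp add: inner_hardy_def hinner_scaleH_left complex_eq_iff)
  qed
  then show "g = 0"
    by (rule orth)
qed

section \<open>Topological transitivity and Baire category\<close>

lemma bounded_linear_funpow:
  fixes T :: "'a::real_normed_vector \<Rightarrow> 'a"
  assumes "bounded_linear T"
  shows "bounded_linear (T ^^ n)"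
proof (induction n)
  case 0
  show ?case by (simp add: id_def bounded_linear_ident)
next
  case (Suc n)
  then show ?case
    using bounded_linear_compose[OF assms, of "T ^^ n"] by (simp add: o_def)
qed

lemma bounded_operator_funpow_scaleH:
  assumes "bounded_operator T"
  shows "(T ^^ n) (scaleH c f) = scaleH c ((T ^^ n) f)"
  by (induction n) (simp_all add: bounded_operatorD(2)[OF assms])

text \<open>Compactness replaces convergence of the preimages to 0: along a subsequence they tend to
  some \<open>l\<close>. If \<open>u\<close> in \<open>X\<close> is chosen so that
  \<open>u + l\<close> lies in \<open>U\<close>, then \<open>u + x (r k)\<close> eventually lies in
  \<open>U\<close> and its image tends to \<open>y\<close>.\<close>

lemma topologically_transitiveI:
  fixes T :: "'a::real_normed_vector \<Rightarrow> 'a"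
  assumes T: "bounded_linear T" and X: "closure X = UNIV" and Y: "closure Y = UNIV"
    and preim: "\<And>y. y \<in> Y \<Longrightarrow> \<exists>m x K. compact K \<and> (\<forall>k::nat. x k \<in> K \<and> (T ^^ m k) (x k) = y) \<and>
                 (\<forall>u\<in>X. (\<lambda>k. (T ^^ m k) u) \<longlonglongrightarrow> 0)"
    and UV: "open U" "open V" "U \<noteq> {}" "V \<noteq> {}"
  shows "\<exists>n. \<exists>f\<in>U. (T ^^ n) f \<in> V"
proof -
  have dense: "\<exists>z\<in>Z. z \<in> W" if "closure Z = UNIV" "open W" "W \<noteq> {}" for Z W :: "'a set"
    using that open_Int_closure_eq_empty[of W Z] by auto
  obtain y where y: "y \<in> Y" "y \<in> V"
    using dense[OF Y UV(2,4)] by blast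
  obtain m x K where K: "compact K" and x: "\<And>k. x k \<in> K" "\<And>k. (T ^^ m k) (x k) = y"
    and m: "\<And>u. u \<in> X \<Longrightarrow> (\<lambda>k. (T ^^ m k) u) \<longlonglongrightarrow> 0"
    using preim[OF y(1)] by blast
  obtain l r where r: "strict_mono (r :: nat \<Rightarrow> nat)" "(x \<circ> r) \<longlonglongrightarrow> l"
    using K x(1) unfolding compact_def by metis
  \<comment> \<open>The translate of \<open>U\<close> by \<open>- l\<close>, so that density of
    \<open>X\<close> yields \<open>u\<close> with \<open>u + l\<close> in \<open>U\<close>.\<close>
  define W where "W = (\<lambda>u. u + l) -` U"
  have "open W"
    unfolding W_def by (intro open_vimage UV continuous_intros)
  moreover from UV(3) obtain u where "u \<in> U" by blast
  then have "u - l \<in> W" by (simp add: W_def)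
  ultimately have "\<exists>z\<in>X. z \<in> W"
    by (intro dense[OF X]) auto
  then obtain u where u: "u \<in> X" "u + l \<in> U"
    by (auto simp: W_def)
  have "(\<lambda>k. u + x (r k)) \<longlonglongrightarrow> u + l"
    using r(2) by (intro tendsto_intros) (simp add: o_def)
  then have 1: "\<forall>\<^sub>F k in sequentially. u + x (r k) \<in> U"
    using UV(1) u(2) by (rule topological_tendstoD)
  have "(\<lambda>k. (T ^^ m (r k)) u + y) \<longlonglongrightarrow> 0 + y"
    using LIMSEQ_subseq_LIMSEQ[OF m[OF u(1)] r(1)] by (intro tendsto_intros) (simp add: o_def)
  moreover have "(T ^^ m (r k)) (u + x (r k)) = (T ^^ m (r k)) u + y" for k
    using linear_add[OF bounded_linear.linear[OF bounded_linear_funpow[OF T]]] by (simp add: x(2))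
  ultimately have "(\<lambda>k. (T ^^ m (r k)) (u + x (r k))) \<longlonglongrightarrow> y"
    by simp
  then have 2: "\<forall>\<^sub>F k in sequentially. (T ^^ m (r k)) (u + x (r k)) \<in> V"
    using UV(2) y(2) by (rule topological_tendstoD)
  obtain k where "u + x (r k) \<in> U" "(T ^^ m (r k)) (u + x (r k)) \<in> V"
    using eventually_happens'[OF _ eventually_conj[OF 1 2]] by auto
  then show ?thesis by blast
qed

text \<open>Birkhoff's transitivity theorem: the vectors with dense orbit contain a countable
  intersection of sets that are open by continuity and dense by transitivity.\<close>

lemma dense_orbit_if_transitive:
  fixes T :: "'a::real_normed_vector \<Rightarrow> 'a"
  assumes T: "bounded_linear T" and complete: "complete (UNIV :: 'a set)"
    and D: "countable D" "closure D = (UNIV :: 'a set)"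
    and trans: "\<And>U V. open U \<Longrightarrow> open V \<Longrightarrow> U \<noteq> {} \<Longrightarrow> V \<noteq> {} \<Longrightarrow> \<exists>n. \<exists>f\<in>U. (T ^^ n) f \<in> V"
  shows "\<exists>f. closure {(T ^^ n) f |n. True} = UNIV"
proof -
  \<comment> \<open>\<open>G (d, j)\<close> consists of the vectors whose orbit meets the ball of
    radius \<open>1 / (j + 1)\<close> about \<open>d\<close>. A vector in all of them comes
    arbitrarily close to every point of \<open>D\<close>.\<close>
  define G where "G = (\<lambda>(d, j). \<Union>n. (T ^^ n) -` ball d (inverse (real (Suc j))))"
  have op: "open (G (d, j))" for d j
    unfolding G_def
    by (auto intro!: open_UN open_vimage linear_continuous_on bounded_linear_funpow T)
  have dn: "closure (G (d, j)) = UNIV" for d j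
  proof -
    have "\<exists>y\<in>G (d, j). dist y x < e" if "e > 0" for x e
    proof -
      obtain n f where "f \<in> ball x e" "(T ^^ n) f \<in> ball d (inverse (real (Suc j)))"
        using trans[of "ball x e" "ball d (inverse (real (Suc j)))"] \<open>e > 0\<close> by auto
      then show ?thesis
        unfolding G_def by (intro bexI[of _ f]) (auto simp: dist_commute)
    qed
    then show ?thesis
      unfolding set_eq_iff closure_approachable by blast
  qed
  have "euclidean closure_of \<Inter>(G ` (D \<times> UNIV)) = topspace (euclidean :: 'a topology)"
  proof (rule Baire_category)
    show "completely_metrizable_space (euclidean :: 'a topology) \<or>
        locally_compact_space (euclidean :: 'a topology) \<and> regular_space (euclidean :: 'a topology)"
      using complete_imp_completely_metrizable_euclidean[OF complete] by blast
    show "countable (G ` (D \<times> (UNIV :: nat set)))"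
      using D by simp
  qed (auto simp: op dn)
  then have "closure (\<Inter>(G ` (D \<times> UNIV))) = UNIV"
    by simp
  then have "\<Inter>(G ` (D \<times> UNIV)) \<noteq> {}"
    using closure_empty by (metis UNIV_not_empty)
  then obtain f where f: "f \<in> \<Inter>(G ` (D \<times> UNIV))"
    by blast
  have "g \<in> closure {(T ^^ n) f |n. True}" for g
    unfolding closure_approachable
  proof (intro allI impI)
    fix e :: real assume "e > 0"
    then obtain j where j: "inverse (real (Suc j)) < e / 2"
      using reals_Archimedean[of "e/2"] by auto
    have "g \<in> closure D" by (simp add: D)
    then obtain d where d: "d \<in> D" "dist d g < e / 2"
      using \<open>e > 0\<close> unfolding closure_approachable by (metis half_gt_zero)
    obtain n where "dist d ((T ^^ n) f) < inverse (real (Suc j))"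
      using f d(1) unfolding G_def by fastforce
    then have "dist ((T ^^ n) f) g < e"
      using dist_triangle[of "(T ^^ n) f" g d] d(2) j by (simp add: dist_commute)
    then show "\<exists>y\<in>{(T ^^ n) f |n. True}. dist y g < e"
      by blast
  qed
  then show ?thesis by blast
qed

section \<open>Complex scaling and separability\<close>

lemma bounded_linear_scaleH_left: "bounded_linear (\<lambda>c. scaleH c f)"
  by (rule bounded_linear_intro[where K = "norm f"])
    (auto intro!: hardy_coeff_eqI simp: scaleR_hardy_def algebra_simps scaleR_conv_of_real)

lemma bounded_linear_scaleH_right: "bounded_linear (scaleH c)"
  by (rule bounded_linear_intro[where K = "cmod c"])
    (auto intro!: hardy_coeff_eqI simp: scaleR_hardy_def algebra_simps)

text \<open>Joint continuity, by splitting \<open>x k\<close> into \<open>f\<close> and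
  \<open>x k - f\<close>; the second part is scaled by a convergent factor and tends to 0.\<close>

lemma tendsto_scaleH:
  assumes "(a \<longlongrightarrow> c) F" "(x \<longlongrightarrow> f) F"
  shows "((\<lambda>k. scaleH (a k) (x k)) \<longlongrightarrow> scaleH c f) F"
proof -
  have "((\<lambda>k. scaleH (a k) f) \<longlongrightarrow> scaleH c f) F"
    by (rule bounded_linear.tendsto[OF bounded_linear_scaleH_left assms(1)])
  moreover have "((\<lambda>k. norm (scaleH (a k) (x k - f))) \<longlongrightarrow> cmod c * norm (f - f)) F"
    unfolding norm_scaleH by (intro tendsto_intros assms)
  then have "((\<lambda>k. scaleH (a k) (x k - f)) \<longlongrightarrow> 0) F"
    by (simp add: tendsto_norm_zero_iff del: norm_scaleH)
  ultimately have "((\<lambda>k. scaleH (a k) f + scaleH (a k) (x k - f)) \<longlongrightarrow> scaleH c f + 0) F"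
    by (rule tendsto_add)
  moreover have "scaleH (a k) f + scaleH (a k) (x k - f) = scaleH (a k) (x k)" for k
    by (rule hardy_coeff_eqI) (simp add: algebra_simps)
  ultimately show ?thesis by simp
qed

text \<open>Polynomials are dense, and each is a limit of polynomials with coefficients in a
  countable dense set of complex numbers.\<close>

lemma countable_dense_hardy: "\<exists>D :: hardy set. countable D \<and> closure D = UNIV"
proof -
  obtain Q :: "complex set" where Q: "countable Q" "\<And>U. open U \<Longrightarrow> U \<noteq> {} \<Longrightarrow> \<exists>q\<in>Q. q \<in> U"
    using countable_dense_setE by blast
  have "\<exists>q. (\<forall>k. q k \<in> Q) \<and> q \<longlonglongrightarrow> c" for c
  proof -
    have "c \<in> closure Q"
      unfolding closure_approachable
    proof (intro allI impI)
      fix e :: real assume "e > 0"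
      then show "\<exists>y\<in>Q. dist y c < e"
        using Q(2)[of "ball c e"] by (auto simp: dist_commute)
    qed
    then show ?thesis
      by (simp add: closure_sequential)
  qed
  then obtain q where q: "\<And>c k. q c k \<in> Q" "\<And>c. q c \<longlonglongrightarrow> c"
    by metis
  \<comment> \<open>Finite lists of coefficients make countability immediate.\<close>
  define D where "D = (\<lambda>xs. hardy_poly (length xs) ((!) xs)) ` lists Q"
  have poly: "hardy_poly N a \<in> closure D" for N a
    unfolding closure_sequential
  proof (intro exI conjI allI)
    fix k
    let ?xs = "map (\<lambda>i. q (a i) k) [0..<N]"
    have "hardy_poly N (\<lambda>i. q (a i) k) = hardy_poly (length ?xs) ((!) ?xs)"
      by (simp add: hardy_poly_def)
    then show "hardy_poly N (\<lambda>i. q (a i) k) \<in> D"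
      unfolding D_def by (rule image_eqI) (auto simp: q)
  next
    show "(\<lambda>k. hardy_poly N (\<lambda>i. q (a i) k)) \<longlonglongrightarrow> hardy_poly N a"
      unfolding hardy_poly_def by (intro tendsto_sum tendsto_scaleH q tendsto_const)
  qed
  have "f \<in> closure D" for f
    using Lim_in_closed_set[OF closed_closure _ _ hardy_poly_tendsto] poly by simp
  moreover have "countable D"
    unfolding D_def using Q(1) by simp
  ultimately show ?thesis by blast
qed

lemma hypercyclicI:
  assumes T: "bounded_operator T" and X: "closure X = UNIV" and Y: "closure Y = UNIV"
    and preim: "\<And>y. y \<in> Y \<Longrightarrow> \<exists>m x K. compact K \<and> (\<forall>k::nat. x k \<in> K \<and> (T ^^ m k) (x k) = y) \<and>
                 (\<forall>u\<in>X. (\<lambda>k. (T ^^ m k) u) \<longlonglongrightarrow> 0)"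
  shows "hypercyclic T"
proof -
  obtain D :: "hardy set" where D: "countable D" "closure D = UNIV"
    using countable_dense_hardy by blast
  show ?thesis
    unfolding hypercyclic_def using T
    by (intro conjI dense_orbit_if_transitive[OF _ complete_hardy D]
        topologically_transitiveI[OF _ X Y preim]) (auto dest: bounded_operatorD(1))
qed

section \<open>Reproducing kernels and the operator\<close>

text \<open>The Szego kernel at \<open>w\<close>, whose closed form is
  \<open>1 / (1 - cnj w * z)\<close>.\<close>

definition kernel :: "complex \<Rightarrow> hardy" where
  "kernel w = hardy_series (\<lambda>n. cnj w ^ n)"

lemma hcoeff_kernel:
  assumes "w \<in> ball 0 1"
  shows "hcoeff (kernel w) n = cnj w ^ n"
proof -
  have "summable (\<lambda>n. ((cmod w)\<^sup>2) ^ n)"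
    using assms by (intro summable_geometric) (simp add: abs_square_less_1)
  then have "summable (\<lambda>n. (cmod (cnj w ^ n))\<^sup>2)"
    by (simp add: norm_power mult.commute flip: power_mult)
  then show ?thesis
    by (simp add: kernel_def hcoeff_hardy_series)
qed

lemma hinner_kernel:
  assumes "w \<in> ball 0 1"
  shows "hinner f (kernel w) = fun_of_hardy f w"
  using fun_of_hardy_sums[OF assms, of f] by (simp add: hinner_def hcoeff_kernel[OF assms] sums_iff)

lemma fun_of_hardy_kernel:
  assumes "w \<in> ball 0 1" "z \<in> ball 0 1"
  shows "fun_of_hardy (kernel w) z = 1 / (1 - cnj w * z)"
proof -
  have "cmod w * cmod z < 1 * 1"
    using assms by (intro mult_strict_mono') auto
  then have "(\<lambda>n. (cnj w * z) ^ n) sums (1 / (1 - cnj w * z))"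
    by (intro geometric_sums) (simp add: norm_mult)
  then show ?thesis
    using fun_of_hardy_sums[OF assms(2), of "kernel w"] assms
    by (simp add: hcoeff_kernel power_mult_distrib sums_iff)
qed

text \<open>The value depends only on \<open>cmod w\<close>, which is why rotating the point leaves
  the norm of its kernel unchanged.\<close>

lemma norm_kernel_sq:
  assumes "w \<in> ball 0 1"
  shows "(norm (kernel w))\<^sup>2 = 1 / (1 - (cmod w)\<^sup>2)"
proof -
  have "(norm (kernel w))\<^sup>2 = Re (hinner (kernel w) (kernel w))"
    by (simp add: power2_norm_eq_inner inner_hardy_def)
  also have "\<dots> = Re (1 / (1 - cnj w * w))"
    using assms by (simp add: hinner_kernel fun_of_hardy_kernel)
  also have "1 / (1 - cnj w * w) = complex_of_real (1 / (1 - (cmod w)\<^sup>2))"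
    using complex_norm_square[of w] by (simp add: mult.commute)
  finally show ?thesis by simp
qed

text \<open>The reproducing property expands the squared norm of \<open>kernel v - kernel w\<close>
  into four explicit fractions, which cancel in the limit. Continuity makes kernels over compact
  sets of points compact.\<close>

lemma continuous_on_kernel: "continuous_on (ball 0 1) kernel"
  unfolding continuous_on_def
proof
  fix w :: complex assume w: "w \<in> ball 0 1"
  let ?F = "at w within ball 0 1"
  have "(cmod w)\<^sup>2 \<noteq> 1"
    using w abs_square_less_1[of "cmod w"] by simp
  moreover have "cnj w * w = complex_of_real ((cmod w)\<^sup>2)"
    by (simp only: complex_norm_square mult.commute)
  ultimately have nz: "1 - cnj w * w \<noteq> 0"
    by (metis of_real_eq_1_iff right_minus_eq)
  have "((\<lambda>v. 1 / (1 - cnj v * v) - 1 / (1 - cnj w * v) - 1 / (1 - cnj v * w) + 1 / (1 - cnj w * w))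
      \<longlongrightarrow> 1 / (1 - cnj w * w) - 1 / (1 - cnj w * w) - 1 / (1 - cnj w * w) + 1 / (1 - cnj w * w)) ?F"
    using nz by (intro tendsto_intros)
  from tendsto_Re[OF this]
  have "((\<lambda>v. Re (1 / (1 - cnj v * v) - 1 / (1 - cnj w * v) - 1 / (1 - cnj v * w) + 1 / (1 - cnj w * w)))
      \<longlongrightarrow> 0) ?F"
    by simp
  moreover have "Re (1 / (1 - cnj v * v) - 1 / (1 - cnj w * v) - 1 / (1 - cnj v * w) + 1 / (1 - cnj w * w)) =
      (norm (kernel v - kernel w))\<^sup>2" if v: "v \<in> ball 0 1" for v
  proof -
    have "(norm (kernel v - kernel w))\<^sup>2 = inner (kernel v) (kernel v) - inner (kernel w) (kernel v)
        - inner (kernel v) (kernel w) + inner (kernel w) (kernel w)"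
      by (simp add: power2_norm_eq_inner inner_diff_left inner_diff_right)
    then show ?thesis
      using v w by (simp add: inner_hardy_def hinner_kernel fun_of_hardy_kernel)
  qed
  then have "\<forall>\<^sub>F v in ?F. Re (1 / (1 - cnj v * v) - 1 / (1 - cnj w * v) - 1 / (1 - cnj v * w) + 1 / (1 - cnj w * w)) =
      (norm (kernel v - kernel w))\<^sup>2"
    unfolding eventually_at_filter by (intro always_eventually) blast
  ultimately have "((\<lambda>v. (norm (kernel v - kernel w))\<^sup>2) \<longlongrightarrow> 0) ?F"
    by (rule Lim_transform_eventually)
  from tendsto_real_sqrt[OF this] have "((\<lambda>v. norm (kernel v - kernel w)) \<longlongrightarrow> 0) ?F"
    by simp
  then show "(kernel \<longlongrightarrow> kernel w) ?F"
    by (simp add: tendsto_norm_zero_iff Lim_null[of _ "kernel w"])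
qed

text \<open>Orthogonality to \<open>kernel w\<close> means that \<open>g\<close> vanishes at
  \<open>w\<close>, so the identity theorem applies at the limit point.\<close>

lemma kernels_total:
  assumes W: "W \<subseteq> ball 0 1" and lp: "\<xi> islimpt W" "\<xi> \<in> ball 0 1"
    and orth: "\<And>w. w \<in> W \<Longrightarrow> hinner (kernel w) g = 0"
  shows "g = 0"
proof (rule hardy_eqI)
  fix z
  have 0: "fun_of_hardy g w = 0" if "w \<in> W" for w
    using orth[OF that] hinner_kernel[of w g] hinner_commute[of g "kernel w"] W that by auto
  show "fun_of_hardy g z = fun_of_hardy 0 z"
  proof (cases "z \<in> ball 0 1")
    case True
    then show ?thesis
      using analytic_continuation[OF holomorphic_fun_of_hardy open_ball connected_ball W lp(2,1) 0]
      by simp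
  qed (simp add: fun_of_hardy_outside)
qed

lemma rot_op_unimodular:
  assumes "cmod lam = 1"
  shows hcoeff_rot_op: "hcoeff (rot_op lam f) n = lam ^ n * hcoeff f n"
    and bounded_operator_rot_op: "bounded_operator (rot_op lam)"
proof -
  have s: "(\<lambda>n. (lam ^ n * hcoeff f n) * z ^ n) sums fun_of_hardy f (lam * z)" if "z \<in> ball 0 1" for f z
    using fun_of_hardy_sums[of "lam * z" f] that assms by (simp add: norm_mult power_mult_distrib mult_ac)
  have h: "(\<lambda>z. fun_of_hardy f (lam * z)) holomorphic_on ball 0 1" for f
    by (rule holomorphic_power_series_on_disc) (rule s)
  have t: "taylor_coeff (\<lambda>z. fun_of_hardy f (lam * z)) = (\<lambda>n. lam ^ n * hcoeff f n)" for f
    by (rule taylor_coeff_power_series) (rule s)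
  have sm: "summable (\<lambda>n. (cmod (taylor_coeff (\<lambda>z. fun_of_hardy f (lam * z)) n))\<^sup>2)" for f
    unfolding t using summable_hcoeff[of f] by (simp add: norm_mult norm_power assms)
  show c: "hcoeff (rot_op lam f) n = lam ^ n * hcoeff f n" for f n
    unfolding rot_op_def by (simp add: hcoeff_hardy_of[OF h sm] t)
  show "bounded_operator (rot_op lam)"
  proof (rule bounded_operatorI[where K = 1])
    show "norm (rot_op lam f) \<le> 1 * norm f" for f
      by (simp add: norm_hardy_def c norm_mult norm_power assms)
  qed (auto intro!: hardy_coeff_eqI simp: c algebra_simps)
qed

lemma Hinfty_conj_fun:
  assumes "\<phi> \<in> Hinfty"
  shows "conj_fun \<phi> \<in> Hinfty"
proof -
  have "cnj ` ball 0 1 = ball 0 1"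
    by (auto simp: image_iff intro!: bexI[of _ "cnj _"])
  then have "cnj \<circ> \<phi> \<circ> cnj holomorphic_on ball 0 1"
    using assms by (intro holomorphic_on_compose_cnj_cnj) (auto simp: Hinfty_def)
  then have "conj_fun \<phi> holomorphic_on ball 0 1"
    by (simp add: o_def conj_fun_def[abs_def])
  moreover have "bounded (conj_fun \<phi> ` ball 0 1)"
  proof -
    obtain C where "\<And>z. z \<in> ball 0 1 \<Longrightarrow> cmod (\<phi> z) \<le> C"
      using assms unfolding Hinfty_def bounded_iff by blast
    then have "cmod (conj_fun \<phi> z) \<le> C" if "z \<in> ball 0 1" for z
      using that by (simp add: conj_fun_def)
    then show ?thesis
      unfolding bounded_iff by blast
  qed
  ultimately show ?thesis
    by (simp add: Hinfty_def)
qed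

section \<open>Action of the operator on kernels and monomials\<close>

context
  fixes lam :: complex and \<phi> :: "complex \<Rightarrow> complex"
    and T :: "hardy \<Rightarrow> hardy"
  assumes lam: "cmod lam = 1" and phi: "\<phi> \<in> Hinfty" and T: "T = rot_op lam \<circ> shift_op \<phi>"
begin

lemma bounded_operator_shift_op: "bounded_operator (shift_op \<phi>)"
  unfolding shift_op_def
  by (intro bounded_operator_hadjoint bounded_operator_mult_op Hinfty_conj_fun phi)

lemma bounded_operator_rot_shift: "bounded_operator T"
  using bounded_operator_shift_op bounded_operator_rot_op[OF lam]
  by (simp add: T bounded_operator_def o_def bounded_linear_compose)

lemma hinner_shift_op: "hinner f (shift_op \<phi> g) = hinner (mult_op (conj_fun \<phi>) f) g"
  unfolding shift_op_def
  by (rule hinner_hadjoint[symmetric]) (intro bounded_operator_mult_op Hinfty_conj_fun phi)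

text \<open>Kernels are eigenvectors of the adjoint of a multiplication operator, and the rotation
  only moves the point of the kernel.\<close>

lemma rot_shift_kernel:
  assumes w: "w \<in> ball 0 1"
  shows "T (kernel w) = scaleH (cnj (conj_fun \<phi> w)) (kernel (cnj lam * w))"
proof -
  have "shift_op \<phi> (kernel w) = scaleH (cnj (conj_fun \<phi> w)) (kernel w)"
    by (rule hinner_eqI) (simp add: hinner_shift_op hinner_kernel[OF w] hinner_scaleH_right
        fun_of_mult_op[OF Hinfty_conj_fun[OF phi] w])
  moreover have "rot_op lam (kernel w) = kernel (cnj lam * w)"
    using w lam by (intro hardy_coeff_eqI)
      (simp add: hcoeff_rot_op[OF lam] hcoeff_kernel norm_mult power_mult_distrib)
  ultimately show ?thesis
    using bounded_operatorD(2)[OF bounded_operator_rot_op[OF lam]] by (simp add: T)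
qed

lemma Psi_Suc: "Psi \<phi> lam (Suc n) z = Psi \<phi> lam n z * conj_fun \<phi> (cnj lam ^ n * z)"
  by (simp add: Psi_def Let_def)

lemma funpow_rot_shift_kernel:
  assumes w: "w \<in> ball 0 1"
  shows "(T ^^ n) (kernel w) = scaleH (cnj (Psi \<phi> lam n w)) (kernel (cnj lam ^ n * w))"
proof (induction n)
  case 0
  show ?case
    by (rule hardy_eqI) (simp add: Psi_def)
next
  case (Suc n)
  have v: "cnj lam ^ n * w \<in> ball 0 1"
    using w lam by (simp add: norm_mult norm_power)
  have "(T ^^ Suc n) (kernel w) = T (scaleH (cnj (Psi \<phi> lam n w)) (kernel (cnj lam ^ n * w)))"
    using Suc by simp
  also have "\<dots> = scaleH (cnj (Psi \<phi> lam n w)) (T (kernel (cnj lam ^ n * w)))"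
    by (rule bounded_operatorD(2)[OF bounded_operator_rot_shift])
  also have "\<dots> = scaleH (cnj (Psi \<phi> lam (Suc n) w)) (kernel (cnj lam ^ Suc n * w))"
    unfolding rot_shift_kernel[OF v]
    by (rule hardy_eqI) (simp add: Psi_Suc mult_ac)
  finally show ?case .
qed

lemma norm_funpow_rot_shift_kernel:
  assumes w: "w \<in> ball 0 1"
  shows "norm ((T ^^ n) (kernel w)) = cmod (Psi \<phi> lam n w) * norm (kernel w)"
proof -
  have v: "cnj lam ^ n * w \<in> ball 0 1" "cmod (cnj lam ^ n * w) = cmod w"
    using w lam by (simp_all add: norm_mult norm_power)
  then have "(norm (kernel (cnj lam ^ n * w)))\<^sup>2 = (norm (kernel w))\<^sup>2"
    by (simp only: norm_kernel_sq w)
  then show ?thesis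
    by (simp add: funpow_rot_shift_kernel[OF w])
qed

text \<open>Multiplication by a power series is lower triangular in the monomial basis, so its
  adjoint is upper triangular; the rotation scales row \<open>i\<close> by
  \<open>lam ^ i\<close>.\<close>

lemma hcoeff_rot_shift_monomial:
  "hcoeff (T (monomial j)) i = (if i \<le> j then lam ^ i * cnj (taylor_coeff (conj_fun \<phi>) (j - i)) else 0)"
proof -
  have "hcoeff (shift_op \<phi> (monomial j)) i = cnj (hinner (monomial i) (shift_op \<phi> (monomial j)))"
    by (simp add: hinner_monomial_left)
  also have "\<dots> = cnj (hcoeff (mult_op (conj_fun \<phi>) (monomial i)) j)"
    by (simp add: hinner_shift_op hinner_monomial_right)
  also have "\<dots> = cnj (\<Sum>k\<le>j. taylor_coeff (conj_fun \<phi>) k * (if j - k = i then 1 else 0))"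
    by (simp add: hcoeff_mult_op[OF Hinfty_conj_fun[OF phi]] hcoeff_monomial)
  also have "(\<Sum>k\<le>j. taylor_coeff (conj_fun \<phi>) k * (if j - k = i then 1 else 0)) =
      (\<Sum>k\<le>j. if i \<le> j \<and> k = j - i then taylor_coeff (conj_fun \<phi>) k else 0)"
    by (intro sum.cong refl) auto
  also have "\<dots> = (if i \<le> j then taylor_coeff (conj_fun \<phi>) (j - i) else 0)"
    by simp
  finally show ?thesis
    by (simp add: T hcoeff_rot_op[OF lam])
qed

lemma hcoeff_rot_shift_monomial_diag: "hcoeff (T (monomial j)) j = \<phi> 0 * lam ^ j"
  by (simp only: hcoeff_rot_shift_monomial) (simp add: taylor_coeff_def conj_fun_def)

end

section \<open>Orbits under the rotation\<close>

text \<open>If the power were 1, its exponent would be an integer multiple of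
  \<open>2 * pi * \<i>\<close>, and \<theta> would be a quotient of integers.\<close>

lemma irrational_rotation_power_neq_1:
  assumes "irrational_rotation lam" "n > 0"
  shows "lam ^ n \<noteq> 1"
proof
  obtain \<theta> :: real where \<theta>: "\<theta> \<notin> \<rat>" "lam = exp (2 * of_real pi * \<i> * of_real \<theta>)"
    using assms(1) unfolding irrational_rotation_def by blast
  assume "lam ^ n = 1"
  then have "exp (of_nat n * (2 * of_real pi * \<i> * of_real \<theta>)) = 1"
    by (simp only: \<theta>(2) exp_of_nat_mult)
  then obtain k :: int where "real n * (2 * pi * \<theta>) = of_int (2 * k) * pi"
    unfolding exp_eq_1 by (auto simp: mult_ac)
  then have "real n * \<theta> = of_int k"
    by simp
  then have "\<theta> = of_int k / of_nat n"
    using assms(2) by (simp add: field_simps)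
  then show False
    using \<theta>(1) by simp
qed

text \<open>The orbit is infinite because \<open>lam\<close> is not a root of unity, and it lies on
  a compact circle inside the disc.\<close>

lemma rotation_orbit_islimpt:
  assumes "cmod lam = 1" "\<And>n. n > 0 \<Longrightarrow> lam ^ n \<noteq> 1" "z \<noteq> 0" "z \<in> ball 0 1"
  shows "\<exists>\<xi>\<in>ball 0 1. \<xi> islimpt range (\<lambda>j. lam ^ j * z)"
proof -
  have l0: "lam \<noteq> 0"
    using assms(1) by auto
  have "inj (\<lambda>j. lam ^ j * z)"
  proof (rule linorder_injI)
    fix i j :: nat assume "i < j"
    then have "lam ^ j = lam ^ i * lam ^ (j - i)"
      by (simp flip: power_add)
    then show "lam ^ i * z \<noteq> lam ^ j * z"
      using assms(2)[of "j - i"] \<open>i < j\<close> \<open>z \<noteq> 0\<close> l0 by simp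
  qed
  then have "infinite (range (\<lambda>j. lam ^ j * z))"
    by (rule range_inj_infinite)
  moreover have "range (\<lambda>j. lam ^ j * z) \<subseteq> sphere 0 (cmod z)"
    using assms(1) by (auto simp: norm_mult norm_power)
  ultimately have "\<exists>\<xi>\<in>sphere 0 (cmod z). \<xi> islimpt range (\<lambda>j. lam ^ j * z)"
    using compact_sphere[of "0::complex" "cmod z"] unfolding compact_eq_Bolzano_Weierstrass by blast
  then show ?thesis
    using assms(4) by auto
qed

text \<open>The index \<open>J\<close> ranges over a family of sequences of powers. Orbits of
  \<open>F\<close> vanish along every sequence, while each \<open>e\<close> needs compactly
  contained preimages only for large \<open>J\<close>, so finitely many generators share one
  sequence. The properties pass to linear combinations, which are dense.\<close>

lemma hypercyclic_by_generators:
  fixes m :: "nat \<Rightarrow> nat \<Rightarrow> nat"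
  assumes T: "bounded_operator T"
    and F: "\<And>u J. u \<in> F \<Longrightarrow> (\<lambda>k. (T ^^ m J k) u) \<longlonglongrightarrow> 0"
    and F_total: "\<And>g. (\<And>u. u \<in> F \<Longrightarrow> hinner u g = 0) \<Longrightarrow> g = 0"
    and E: "\<And>e. e \<in> E \<Longrightarrow> \<exists>J0. \<forall>J\<ge>J0. \<exists>K x. compact K \<and> (\<forall>k. x k \<in> K \<and> (T ^^ m J k) (x k) = e)"
    and E_total: "\<And>g. (\<And>e. e \<in> E \<Longrightarrow> hinner e g = 0) \<Longrightarrow> g = 0"
  shows "hypercyclic T"
proof -
  define X where "X = {u. \<forall>J. (\<lambda>k. (T ^^ m J k) u) \<longlonglongrightarrow> 0}"
  define Y where "Y = {e. \<exists>J0. \<forall>J\<ge>J0. \<exists>K x. compact K \<and> (\<forall>k. x k \<in> K \<and> (T ^^ m J k) (x k) = e)}"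
  note blT = bounded_linear_funpow[OF bounded_operatorD(1)[OF T]]
  have add: "(T ^^ n) (f + g) = (T ^^ n) f + (T ^^ n) g" for n f g
    by (rule linear_add[OF bounded_linear.linear[OF blT]])
  have zero: "(T ^^ n) 0 = 0" for n
    by (rule linear_0[OF bounded_linear.linear[OF blT]])
  note scale = bounded_operator_funpow_scaleH[OF T]
  have "closure X = UNIV"
  proof (rule dense_complex_subspaceI)
    show "0 \<in> X"
      by (simp add: X_def zero)
    show "x + y \<in> X" if "x \<in> X" "y \<in> X" for x y
      using that unfolding X_def by (auto simp: add intro: tendsto_add_zero)
    show "scaleH c x \<in> X" if "x \<in> X" for c x
      using that bounded_linear.tendsto_zero[OF bounded_linear_scaleH_right] unfolding X_def
      by (auto simp: scale)
    show "g = 0" if "\<And>s. s \<in> X \<Longrightarrow> hinner s g = 0" for g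
      using that F by (intro F_total) (auto simp: X_def)
  qed
  moreover have "closure Y = UNIV"
  proof (rule dense_complex_subspaceI)
    show "0 \<in> Y"
      unfolding Y_def by (auto simp: zero intro!: exI[of _ "{0}"] exI[of _ "\<lambda>_. 0"])
    show "y + z \<in> Y" if y: "y \<in> Y" and z: "z \<in> Y" for y z
    proof -
      obtain J1 where J1: "\<And>J. J \<ge> J1 \<Longrightarrow> \<exists>K x. compact K \<and> (\<forall>k. x k \<in> K \<and> (T ^^ m J k) (x k) = y)"
        using y unfolding Y_def by blast
      obtain J2 where J2: "\<And>J. J \<ge> J2 \<Longrightarrow> \<exists>K x. compact K \<and> (\<forall>k. x k \<in> K \<and> (T ^^ m J k) (x k) = z)"
        using z unfolding Y_def by blast
      \<comment> \<open>From the larger threshold on, both summands have preimages for the same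
        powers; their sums lie in the compact set of all sums from \<open>K\<close> and
        \<open>L\<close>.\<close>
      have "\<exists>K x. compact K \<and> (\<forall>k. x k \<in> K \<and> (T ^^ m J k) (x k) = y + z)" if "J \<ge> max J1 J2" for J
      proof -
        have J: "J \<ge> J1" "J \<ge> J2"
          using that by simp_all
        obtain K x where 1: "compact K" "\<forall>k. x k \<in> K \<and> (T ^^ m J k) (x k) = y"
          using J1[OF J(1)] by blast
        obtain L v where 2: "compact L" "\<forall>k. v k \<in> L \<and> (T ^^ m J k) (v k) = z"
          using J2[OF J(2)] by blast
        show ?thesis
          using 1 2 compact_sums[OF 1(1) 2(1)]
          by (intro exI[of _ "{a + b |a b. a \<in> K \<and> b \<in> L}"] exI[of _ "\<lambda>k. x k + v k"]) (auto simp: add)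
      qed
      then show ?thesis
        unfolding Y_def by blast
    qed
    show "scaleH c y \<in> Y" if y: "y \<in> Y" for c y
    proof -
      obtain J1 where J1: "\<And>J. J \<ge> J1 \<Longrightarrow> \<exists>K x. compact K \<and> (\<forall>k. x k \<in> K \<and> (T ^^ m J k) (x k) = y)"
        using y unfolding Y_def by blast
      have "\<exists>K x. compact K \<and> (\<forall>k. x k \<in> K \<and> (T ^^ m J k) (x k) = scaleH c y)" if J: "J \<ge> J1" for J
      proof -
        obtain K x where 1: "compact K" "\<forall>k. x k \<in> K \<and> (T ^^ m J k) (x k) = y"
          using J1[OF J] by blast
        have "compact (scaleH c ` K)"
          by (intro compact_continuous_image linear_continuous_on bounded_linear_scaleH_right 1)
        then show ?thesis
          using 1 by (intro exI[of _ "scaleH c ` K"] exI[of _ "\<lambda>k. scaleH c (x k)"]) (auto simp: scale)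
      qed
      then show ?thesis
        unfolding Y_def by blast
    qed
    show "g = 0" if "\<And>s. s \<in> Y \<Longrightarrow> hinner s g = 0" for g
      using that E by (intro E_total) (auto simp: Y_def)
  qed
  ultimately show ?thesis
  proof (rule hypercyclicI[OF T])
    fix y assume "y \<in> Y"
    then obtain J K x where "compact K" "\<forall>k. x k \<in> K \<and> (T ^^ m J k) (x k) = y"
      unfolding Y_def by blast
    then show "\<exists>m x K. compact K \<and> (\<forall>k::nat. x k \<in> K \<and> (T ^^ m k) (x k) = y) \<and>
        (\<forall>u\<in>X. (\<lambda>k. (T ^^ m k) u) \<longlonglongrightarrow> 0)"
      unfolding X_def by blast
  qed
qed

text \<open>Induction on the degree: subtracting a multiple of \<open>p N\<close> removes the top
  coefficient.\<close>

lemma triangular_basis_span: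
  assumes p: "\<And>j. j < N \<Longrightarrow> hcoeff (p j) j = 1 \<and> (\<forall>n>j. hcoeff (p j) n = 0)"
    and g: "\<And>n. n \<ge> N \<Longrightarrow> hcoeff g n = 0"
  shows "\<exists>b. g = (\<Sum>j<N. scaleH (b j) (p j))"
  using assms
proof (induction N arbitrary: g)
  case 0
  then show ?case
    by (auto intro!: hardy_coeff_eqI)
next
  case (Suc N)
  define h where "h = g - scaleH (hcoeff g N) (p N)"
  have "hcoeff h n = 0" if "n \<ge> N" for n
    using that Suc.prems by (cases "n = N") (auto simp: h_def)
  then obtain b where b: "h = (\<Sum>j<N. scaleH (b j) (p j))"
    using Suc.IH[of h] Suc.prems(1) by auto
  have "g = h + scaleH (hcoeff g N) (p N)"
    by (simp add: h_def)
  also have "\<dots> = (\<Sum>j<Suc N. scaleH ((b(N := hcoeff g N)) j) (p j))"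
    by (simp add: b)
  finally show ?case by blast
qed

text \<open>Eigenvectors are built degree by degree: the defect \<open>g\<close> of
  \<open>monomial N\<close> has lower degree, hence is a combination of the eigenvectors found so
  far.\<close>

lemma triangular_eigenvectors:
  assumes T: "bounded_operator T"
    and diag: "\<And>j. hcoeff (T (monomial j)) j = \<mu> j"
    and upper: "\<And>i j. j < i \<Longrightarrow> hcoeff (T (monomial j)) i = 0"
    and \<mu>: "inj \<mu>"
  shows "\<exists>p. \<forall>j<N. T (p j) = scaleH (\<mu> j) (p j) \<and> hcoeff (p j) j = 1 \<and> (\<forall>n>j. hcoeff (p j) n = 0)"
proof (induction N)
  case (Suc N)
  then obtain p where p: "\<And>j. j < N \<Longrightarrow> T (p j) = scaleH (\<mu> j) (p j)"
      "\<And>j. j < N \<Longrightarrow> hcoeff (p j) j = 1 \<and> (\<forall>n>j. hcoeff (p j) n = 0)"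
    by blast
  define g where "g = T (monomial N) - scaleH (\<mu> N) (monomial N)"
  have "hcoeff g n = 0" if "n \<ge> N" for n
    using that by (cases "n = N") (simp_all add: g_def hcoeff_monomial diag upper)
  then obtain b where b: "g = (\<Sum>j<N. scaleH (b j) (p j))"
    using triangular_basis_span[of N p g] p(2) by blast
  \<comment> \<open>A correction \<open>c * p j\<close> changes the defect by
    \<open>c * (\<mu> j - \<mu> N) * p j\<close>; these coefficients cancel \<open>g\<close>, and
    distinct eigenvalues keep the denominators nonzero.\<close>
  define q where "q = monomial N + (\<Sum>j<N. scaleH (b j / (\<mu> N - \<mu> j)) (p j))"
  have \<mu>': "\<mu> N - \<mu> j \<noteq> 0" if "j < N" for j
    using injD[OF \<mu>, of N j] that by auto
  have "T q = T (monomial N) + (\<Sum>j<N. scaleH (b j / (\<mu> N - \<mu> j)) (scaleH (\<mu> j) (p j)))"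
    by (simp add: q_def bounded_operatorD[OF T] p(1))
  also have "T (monomial N) = scaleH (\<mu> N) (monomial N) + (\<Sum>j<N. scaleH (b j) (p j))"
    using b by (simp add: g_def algebra_simps)
  finally have Tq: "T q = scaleH (\<mu> N) (monomial N) + (\<Sum>j<N. scaleH (b j) (p j)) +
      (\<Sum>j<N. scaleH (b j / (\<mu> N - \<mu> j)) (scaleH (\<mu> j) (p j)))" .
  have "T q = scaleH (\<mu> N) q"
  proof (rule hardy_coeff_eqI)
    fix n
    have "hcoeff (T q) n = \<mu> N * hcoeff (monomial N) n +
        (\<Sum>j<N. b j * hcoeff (p j) n + b j / (\<mu> N - \<mu> j) * (\<mu> j * hcoeff (p j) n))"
      by (simp add: Tq sum.distrib)
    also have "(\<Sum>j<N. b j * hcoeff (p j) n + b j / (\<mu> N - \<mu> j) * (\<mu> j * hcoeff (p j) n)) =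
        (\<Sum>j<N. \<mu> N * (b j / (\<mu> N - \<mu> j) * hcoeff (p j) n))"
      by (intro sum.cong refl) (use \<mu>' in \<open>simp add: field_simps\<close>)
    also have "\<mu> N * hcoeff (monomial N) n + \<dots> = hcoeff (scaleH (\<mu> N) q) n"
      by (simp add: q_def distrib_left sum_distrib_left)
    finally show "hcoeff (T q) n = hcoeff (scaleH (\<mu> N) q) n" .
  qed
  moreover have "hcoeff q N = 1" "\<forall>n>N. hcoeff q n = 0"
    using p(2) by (auto simp: q_def hcoeff_monomial)
  ultimately show ?case
    using p by (intro exI[of _ "p(N := q)"]) (auto simp: less_Suc_eq)
qed simp

section \<open>Products of the symbol along rotation orbits\<close>

lemma Omega_eq: "cmod lam = 1 \<Longrightarrow> Omega \<phi> lam n z = (\<Prod>j=1..n. conj_fun \<phi> (lam ^ j * z))"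
proof -
  assume "cmod lam = 1"
  then have "lam * cnj lam = 1"
    using complex_norm_square[of lam] by simp
  then have "1 / cnj lam = lam"
    by (subst divide_eq_eq) auto
  then show ?thesis
    by (simp add: Omega_def)
qed

text \<open>The factors of \<open>Psi\<close> run back along the orbit from exponent
  \<open>m + j\<close> to \<open>j + 1\<close>. The weight in \<open>T ^^ m\<close> at the rotated
  point is therefore a block of consecutive factors of \<open>Omega\<close>.\<close>

lemma Psi_rotated_backwards:
  assumes "cmod lam = 1"
  shows "Psi \<phi> lam m (lam ^ (m + j) * z) = (\<Prod>i=j+1..j+m. conj_fun \<phi> (lam ^ i * z))"
proof -
  have u: "cnj lam * lam = 1"
    using assms complex_norm_square[of lam] by (simp add: mult.commute)
  have "cnj lam ^ i * (lam ^ (m + j) * z) = lam ^ (j + m - i) * z" if "i < m" for i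
  proof -
    have "lam ^ (m + j) = lam ^ i * lam ^ (j + m - i)"
      using that by (simp add: add.commute flip: power_add)
    then have "cnj lam ^ i * (lam ^ (m + j) * z) = (cnj lam * lam) ^ i * (lam ^ (j + m - i) * z)"
      by (simp add: power_mult_distrib)
    then show ?thesis by (simp add: u)
  qed
  then have "Psi \<phi> lam m (lam ^ (m + j) * z) = (\<Prod>i<m. conj_fun \<phi> (lam ^ (j + m - i) * z))"
    unfolding Psi_def Let_def by (intro prod.cong) (simp_all only: lessThan_iff)
  also have "\<dots> = (\<Prod>i=j+1..j+m. conj_fun \<phi> (lam ^ i * z))"
    by (rule prod.reindex_bij_witness[where i = "\<lambda>i. j + m - i" and j = "\<lambda>i. j + m - i"]) auto
  finally show ?thesis .
qed

section \<open>Hypercyclicity\<close>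

lemma continuous_on_scaleH:
  assumes "continuous_on S a" "continuous_on S x"
  shows "continuous_on S (\<lambda>p. scaleH (a p) (x p))"
  using assms unfolding continuous_on_def by (auto intro: tendsto_scaleH)

lemma conj_fun_bounded:
  assumes "\<phi> \<in> Hinfty"
  obtains C where "C \<ge> 1" "\<And>z. z \<in> ball 0 1 \<Longrightarrow> cmod (conj_fun \<phi> z) \<le> C"
proof -
  obtain B where B: "\<And>z. z \<in> ball 0 1 \<Longrightarrow> cmod (conj_fun \<phi> z) \<le> B"
    using Hinfty_conj_fun[OF assms] unfolding Hinfty_def bounded_iff by blast
  show thesis
    by (rule that[of "max 1 B"]) (use B in \<open>auto simp: le_max_iff_disj\<close>)
qed

text \<open>The preimage of the kernel at \<open>lam ^ j * z0\<close> is a kernel further along the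
  orbit divided by its weight. Using the powers \<open>n (k + J) - J\<close> with
  \<open>j \<le> J\<close> makes this weight \<open>Omega\<close> at index \<open>n (k + J)\<close>
  without exactly \<open>J\<close> factors, so it stays away from 0.\<close>

lemma hypercyclic_if_contractive_at_0:
  fixes n :: "nat \<Rightarrow> nat"
  assumes lam: "cmod lam = 1" and irr: "irrational_rotation lam" and phi: "\<phi> \<in> Hinfty"
    and T: "T = rot_op lam \<circ> shift_op \<phi>" and small: "cmod (\<phi> 0) < 1"
    and n: "strict_mono n" and z0: "z0 \<in> ball 0 1" and c: "c > 0"
    and lower: "\<And>k. cmod (Omega \<phi> lam (n k) z0) > c"
  shows "hypercyclic T"
proof -
  define \<psi> where "\<psi> = conj_fun \<phi>"
  note kernelT = funpow_rot_shift_kernel[OF lam phi T] norm_funpow_rot_shift_kernel[OF lam phi T]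
  have bT: "bounded_operator T"
    by (rule bounded_operator_rot_shift[OF lam phi T])
  have psi0: "cmod (\<psi> 0) < 1"
    using small by (simp add: \<psi>_def conj_fun_def)
  have inc: "k \<le> n k" for k
    using n by (rule strict_mono_imp_increasing)
  obtain C where C: "C \<ge> 1" "\<And>z. z \<in> ball 0 1 \<Longrightarrow> cmod (\<psi> z) \<le> C"
    unfolding \<psi>_def using conj_fun_bounded[OF phi] by blast
  obtain \<delta> q where \<delta>: "0 < \<delta>" "\<delta> < 1" and q: "0 \<le> q" "q < 1"
    and small_disc: "\<And>z. z \<in> ball 0 \<delta> \<Longrightarrow> cmod (\<psi> z) \<le> q"
  proof -
    \<comment> \<open>The midpoint between \<open>cmod (\<psi> 0)\<close> and 1 leaves room for
      continuity on a small disc, which rotations preserve.\<close>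
    define q where "q = (1 + cmod (\<psi> 0)) / 2"
    have "continuous_on (ball 0 1) \<psi>"
      using Hinfty_conj_fun[OF phi] by (auto simp: Hinfty_def \<psi>_def intro: holomorphic_on_imp_continuous_on)
    then have "(\<psi> \<longlongrightarrow> \<psi> 0) (at 0)"
      by (simp add: continuous_on_eq_continuous_at isCont_def)
    then have "((\<lambda>z. cmod (\<psi> z)) \<longlongrightarrow> cmod (\<psi> 0)) (at 0)"
      by (rule tendsto_norm)
    moreover have "cmod (\<psi> 0) < q"
      using psi0 by (simp add: q_def)
    ultimately have "\<forall>\<^sub>F z in at 0. cmod (\<psi> z) < q"
      by (rule order_tendstoD(2))
    then obtain d where d: "d > 0" "\<And>z. z \<noteq> 0 \<Longrightarrow> dist z 0 < d \<Longrightarrow> cmod (\<psi> z) < q"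
      unfolding eventually_at by auto
    show thesis
    proof (rule that[of "min d (1/2)" q])
      show "cmod (\<psi> z) \<le> q" if "z \<in> ball 0 (min d (1/2))" for z
        using d(2)[of z] \<open>cmod (\<psi> 0) < q\<close> that by (cases "z = 0") auto
    qed (use d(1) psi0 in \<open>auto simp: q_def\<close>)
  qed
  have Psi_le: "cmod (Psi \<phi> lam m w) \<le> q ^ m" if w: "w \<in> ball 0 \<delta>" for m w
  proof -
    have "cmod (Psi \<phi> lam m w) = (\<Prod>j<m. cmod (\<psi> (cnj lam ^ j * w)))"
      by (simp add: Psi_def prod_norm \<psi>_def)
    also have "\<dots> \<le> (\<Prod>j<m. q)"
      using w lam by (intro prod_mono conjI small_disc) (auto simp: norm_mult norm_power)
    finally show ?thesis by simp
  qed
  \<comment> \<open>At the origin \<open>Omega\<close> would be a power of \<psi>(0), tending to 0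
    against the lower bound.\<close>
  have z0_nz: "z0 \<noteq> 0"
  proof
    assume "z0 = 0"
    then have "cmod (Omega \<phi> lam (n k) z0) = cmod (\<psi> 0) ^ n k" for k
      by (simp add: Omega_eq[OF lam] \<psi>_def norm_power)
    moreover obtain k where "cmod (\<psi> 0) ^ k < c"
      using real_arch_pow_inv[OF c psi0] by blast
    moreover have "cmod (\<psi> 0) ^ n k \<le> cmod (\<psi> 0) ^ k" for k
      using psi0 inc by (intro power_decreasing) auto
    ultimately show False
      using lower[of k] by (metis less_trans not_less)
  qed
  have orbit: "lam ^ i * z0 \<in> ball 0 1" "lam ^ i * z0 \<in> sphere 0 (cmod z0)" for i
    using z0 lam by (simp_all add: norm_mult norm_power)
  show ?thesis
  proof (rule hypercyclic_by_generators[OF bT, where m = "\<lambda>J k. n (k + J) - J"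
        and F = "kernel ` ball 0 \<delta>" and E = "kernel ` range (\<lambda>j. lam ^ j * z0)"])
    fix u J assume "u \<in> kernel ` ball 0 \<delta>"
    then obtain w where w: "w \<in> ball 0 \<delta>" "u = kernel w" by blast
    have w1: "w \<in> ball 0 1"
      using w(1) \<delta> by simp
    show "(\<lambda>k. (T ^^ (n (k + J) - J)) u) \<longlonglongrightarrow> 0"
    proof (rule Lim_null_comparison)
      have "norm ((T ^^ (n (k + J) - J)) u) \<le> q ^ k * norm (kernel w)" for k
      proof -
        have "norm ((T ^^ (n (k + J) - J)) u) \<le> q ^ (n (k + J) - J) * norm (kernel w)"
          unfolding w(2) kernelT(2)[OF w1] by (intro mult_right_mono Psi_le w(1)) simp
        also have "\<dots> \<le> q ^ k * norm (kernel w)"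
          using q inc[of "k + J"] by (intro mult_right_mono power_decreasing) auto
        finally show ?thesis .
      qed
      then show "\<forall>\<^sub>F k in sequentially. norm ((T ^^ (n (k + J) - J)) u) \<le> q ^ k * norm (kernel w)"
        by simp
      show "(\<lambda>k. q ^ k * norm (kernel w)) \<longlonglongrightarrow> 0"
        using q by (intro tendsto_mult_left_zero LIMSEQ_realpow_zero)
    qed
  next
    fix g assume "hinner u g = 0" if "u \<in> kernel ` ball 0 \<delta>" for u
    then show "g = 0"
      using \<delta> by (intro kernels_total[of "ball 0 \<delta>" 0 g]) (auto simp: islimpt_ball)
  next
    fix g assume orth: "hinner e g = 0" if "e \<in> kernel ` range (\<lambda>j. lam ^ j * z0)" for e
    obtain \<xi> where "\<xi> \<in> ball 0 1" "\<xi> islimpt range (\<lambda>j. lam ^ j * z0)"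
      using rotation_orbit_islimpt[OF lam irrational_rotation_power_neq_1[OF irr] z0_nz z0] by blast
    then show "g = 0"
      using orth orbit(1) by (intro kernels_total[of "range (\<lambda>j. lam ^ j * z0)" \<xi> g]) auto
  next
    fix e assume "e \<in> kernel ` range (\<lambda>j. lam ^ j * z0)"
    then obtain j where e: "e = kernel (lam ^ j * z0)" by blast
    show "\<exists>J0. \<forall>J\<ge>J0. \<exists>K x. compact K \<and> (\<forall>k. x k \<in> K \<and> (T ^^ (n (k + J) - J)) (x k) = e)"
    proof (intro exI[of _ j] allI impI)
      fix J assume J: "j \<le> J"
      define m where "m k = n (k + J) - J" for k
      define P where "P k = Psi \<phi> lam (m k) (lam ^ (m k + j) * z0)" for k
      define x where "x k = scaleH (1 / cnj (P k)) (kernel (lam ^ (m k + j) * z0))" for k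
      have P_lower: "c < cmod (P k) * C ^ J" for k
      proof -
        \<comment> \<open>Monotonicity gives \<open>k + J \<le> n (k + J)\<close>, so the natural
          subtraction loses nothing.\<close>
        have mk: "n (k + J) = m k + J"
          using inc[of "k + J"] by (simp add: m_def)
        let ?A = "{1..m k + J}" and ?B = "{j + 1..j + m k}"
        have sub: "?B \<subseteq> ?A"
          using J by auto
        \<comment> \<open>Each of the \<open>J\<close> omitted factors is at most \<open>C\<close>,
          so dropping them costs at most \<open>C ^ J\<close>.\<close>
        have "card (?A - ?B) = J"
          using card_Diff_subset[OF _ sub] by simp
        then have "(\<Prod>i\<in>?A - ?B. cmod (\<psi> (lam ^ i * z0))) \<le> C ^ J"
          using prod_mono[of "?A - ?B" "\<lambda>i. cmod (\<psi> (lam ^ i * z0))" "\<lambda>_. C"] C(2) orbit(1) by simp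
        moreover have "cmod (Omega \<phi> lam (n (k + J)) z0) =
            (\<Prod>i\<in>?A - ?B. cmod (\<psi> (lam ^ i * z0))) * cmod (P k)"
          unfolding Omega_eq[OF lam] mk P_def Psi_rotated_backwards[OF lam] \<psi>_def[symmetric] prod_norm[symmetric]
          by (rule prod.subset_diff[OF sub]) simp
        ultimately have "cmod (Omega \<phi> lam (n (k + J)) z0) \<le> C ^ J * cmod (P k)"
          by (simp add: mult_right_mono)
        then show ?thesis
          using lower[of "k + J"] by (simp add: mult.commute)
      qed
      have CJ: "C ^ J > 0"
        using C(1) by simp
      have P_nz: "P k \<noteq> 0" for k
        using P_lower[of k] c by auto
      have "cmod (1 / cnj (P k)) \<le> C ^ J / c" for k
        using P_lower[of k] P_nz[of k] c CJ by (simp add: norm_divide field_simps)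
      \<comment> \<open>All preimages have bounded scalars and points on one circle, so they lie in
        a continuous image of a compact product.\<close>
      moreover define K where "K = (\<lambda>(a, v). scaleH a (kernel v)) ` (cball 0 (C ^ J / c) \<times> sphere 0 (cmod z0))"
      ultimately have "x k \<in> K" for k
        unfolding K_def x_def using orbit(2)
        by (intro image_eqI[of _ _ "(1 / cnj (P k), lam ^ (m k + j) * z0)"]) auto
      moreover have "compact K"
      proof -
        let ?A = "cball 0 (C ^ J / c) \<times> sphere 0 (cmod z0)"
        have "continuous_on ?A fst" "continuous_on ?A (\<lambda>p. kernel (snd p))"
          using z0 by (auto intro!: continuous_on_compose2[OF continuous_on_kernel] continuous_intros)
        then have "continuous_on ?A (\<lambda>p. scaleH (fst p) (kernel (snd p)))"
          by (rule continuous_on_scaleH)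
        then have "continuous_on ?A (\<lambda>(a, v). scaleH a (kernel v))"
          by (simp only: split_def)
        then show ?thesis
          unfolding K_def by (intro compact_continuous_image compact_Times) auto
      qed
      moreover have "(T ^^ m k) (x k) = e" for k
      proof -
        have "cnj lam ^ m k * (lam ^ (m k + j) * z0) = (lam * cnj lam) ^ m k * (lam ^ j * z0)"
          by (simp add: power_add power_mult_distrib)
        also have "lam * cnj lam = 1"
          using lam complex_norm_square[of lam] by simp
        finally have *: "cnj lam ^ m k * (lam ^ (m k + j) * z0) = lam ^ j * z0"
          by simp
        show ?thesis
          unfolding x_def e bounded_operator_funpow_scaleH[OF bT] kernelT(1)[OF orbit(1)] *
          using P_nz[of k] by (intro hardy_eqI) (simp add: P_def)
      qed
      ultimately show "\<exists>K x. compact K \<and> (\<forall>k. x k \<in> K \<and> (T ^^ (n (k + J) - J)) (x k) = e)"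
        unfolding m_def by blast
    qed
  qed
qed

text \<open>Both sides are \<open>Psi\<close> at index \<open>j + n\<close>, split after the first
  \<open>j\<close> or after the first \<open>n\<close> factors. This compares the weight at a
  rotated point with the weight at \<open>z\<close>.\<close>

lemma Psi_forward:
  "Psi \<phi> lam n (cnj lam ^ j * z) * Psi \<phi> lam j z = Psi \<phi> lam n z * (\<Prod>i<j. conj_fun \<phi> (cnj lam ^ (n + i) * z))"
proof -
  have *: "Psi \<phi> lam (a + b) z = Psi \<phi> lam a z * (\<Prod>i<b. conj_fun \<phi> (cnj lam ^ (a + i) * z))" for a b
    by (induction b) (simp_all add: Psi_def Let_def)
  have "Psi \<phi> lam n (cnj lam ^ j * z) = (\<Prod>i<n. conj_fun \<phi> (cnj lam ^ (j + i) * z))"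
    by (simp add: Psi_def Let_def power_add mult_ac)
  then have "Psi \<phi> lam n (cnj lam ^ j * z) * Psi \<phi> lam j z = Psi \<phi> lam (j + n) z"
    by (simp add: *[of j n])
  also have "\<dots> = Psi \<phi> lam n z * (\<Prod>i<j. conj_fun \<phi> (cnj lam ^ (n + i) * z))"
    by (simp add: *[of n j] add.commute[of j n])
  finally show ?thesis .
qed

text \<open>The generators with vanishing orbits are kernels on a rotation orbit of
  \<open>z1\<close>; those with preimages are eigenvectors, divided by powers of eigenvalues of
  modulus at least 1. One sequence of powers serves for every \<open>J\<close>.\<close>

lemma hypercyclic_if_expansive_at_0:
  fixes n :: "nat \<Rightarrow> nat"
  assumes lam: "cmod lam = 1" and irr: "irrational_rotation lam" and phi: "\<phi> \<in> Hinfty"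
    and T: "T = rot_op lam \<circ> shift_op \<phi>" and large: "cmod (\<phi> 0) \<ge> 1"
    and n: "strict_mono n" and z1: "z1 \<in> ball 0 1"
    and upper: "(\<lambda>k. Psi \<phi> lam (n k) z1) \<longlonglongrightarrow> 0"
  shows "hypercyclic T"
proof -
  define \<psi> where "\<psi> = conj_fun \<phi>"
  note norm_kernelT = norm_funpow_rot_shift_kernel[OF lam phi T]
  have bT: "bounded_operator T"
    by (rule bounded_operator_rot_shift[OF lam phi T])
  have u: "cnj lam * lam = 1"
    using lam complex_norm_square[of lam] by (simp add: mult.commute)
  have inc: "k \<le> n k" for k
    using n by (rule strict_mono_imp_increasing)
  obtain C where C: "C \<ge> 1" "\<And>z. z \<in> ball 0 1 \<Longrightarrow> cmod (\<psi> z) \<le> C"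
    unfolding \<psi>_def using conj_fun_bounded[OF phi] by blast
  have not_root: "lam ^ j \<noteq> 1" "cnj lam ^ j \<noteq> 1" if "j > 0" for j
  proof -
    show "lam ^ j \<noteq> 1"
      by (rule irrational_rotation_power_neq_1[OF irr that])
    then show "cnj lam ^ j \<noteq> 1"
      by (metis complex_cnj_one complex_cnj_power complex_cnj_cnj)
  qed
  \<comment> \<open>At the origin the modulus of \<open>Psi\<close> would be a power of
    \<open>cmod (\<phi> 0)\<close>, hence at least 1.\<close>
  have z1_nz: "z1 \<noteq> 0"
  proof
    assume "z1 = 0"
    then have eq: "cmod (Psi \<phi> lam (n k) z1) = cmod (\<phi> 0) ^ n k" for k
      by (simp add: Psi_def conj_fun_def norm_power)
    have "(\<lambda>k. cmod (Psi \<phi> lam (n k) z1)) \<longlonglongrightarrow> 0"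
      using upper by (rule tendsto_norm_zero)
    moreover have "\<forall>\<^sub>F k in sequentially. 1 \<le> cmod (Psi \<phi> lam (n k) z1)"
      unfolding eq using large by (simp add: one_le_power)
    ultimately have "(1::real) \<le> 0"
      by (intro tendsto_lowerbound) auto
    then show False by simp
  qed
  \<comment> \<open>The direction of rotation depends on zeros of \<psi> along the forward orbit of
    \<open>z1\<close>. Without zeros, decay carries forward after dividing by \<open>Psi\<close> at
    index \<open>j\<close>. With a zero, every backward rotate of \<open>z1\<close> meets it later,
    and its products are eventually 0.\<close>
  obtain \<kappa> where \<kappa>: "cmod \<kappa> = 1" "\<And>j. j > 0 \<Longrightarrow> \<kappa> ^ j \<noteq> 1"
    and decay: "\<And>j. (\<lambda>k. Psi \<phi> lam (n k) (\<kappa> ^ j * z1)) \<longlonglongrightarrow> 0"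
  proof (cases "\<exists>i. \<psi> (cnj lam ^ i * z1) = 0")
    case True
    then obtain i where i: "\<psi> (cnj lam ^ i * z1) = 0" by blast
    have "(\<lambda>k. Psi \<phi> lam (n k) (lam ^ j * z1)) \<longlonglongrightarrow> 0" for j
    proof (rule tendsto_eventually, rule eventually_sequentiallyI)
      fix k assume "Suc (i + j) \<le> k"
      then have "i + j < n k"
        using inc[of k] by simp
      moreover have "cnj lam ^ (i + j) * (lam ^ j * z1) = cnj lam ^ i * ((cnj lam * lam) ^ j * z1)"
        by (simp add: power_add power_mult_distrib mult_ac)
      then have "conj_fun \<phi> (cnj lam ^ (i + j) * (lam ^ j * z1)) = 0"
        using i by (simp only: u \<psi>_def power_one mult_1)
      ultimately show "Psi \<phi> lam (n k) (lam ^ j * z1) = 0"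
        unfolding Psi_def Let_def by (intro prod_zero) auto
    qed
    then show thesis
      using lam not_root(1) by (intro that[of lam]) auto
  next
    case False
    have "(\<lambda>k. Psi \<phi> lam (n k) (cnj lam ^ j * z1)) \<longlonglongrightarrow> 0" for j
    proof (rule Lim_null_comparison)
      have nz: "Psi \<phi> lam j z1 \<noteq> 0"
        using False by (simp add: Psi_def \<psi>_def)
      have "cmod (Psi \<phi> lam (n k) (cnj lam ^ j * z1)) \<le> cmod (Psi \<phi> lam (n k) z1) * (C ^ j / cmod (Psi \<phi> lam j z1))" for k
      proof -
        have "(\<Prod>i<j. cmod (\<psi> (cnj lam ^ (n k + i) * z1))) \<le> (\<Prod>i<j. C)"
          using z1 lam by (intro prod_mono conjI C(2)) (auto simp: norm_mult norm_power)
        then have "cmod (\<Prod>i<j. \<psi> (cnj lam ^ (n k + i) * z1)) \<le> C ^ j"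
          by (simp add: prod_norm)
        then have "cmod (Psi \<phi> lam (n k) (cnj lam ^ j * z1)) * cmod (Psi \<phi> lam j z1) \<le> cmod (Psi \<phi> lam (n k) z1) * C ^ j"
          unfolding norm_mult[symmetric] Psi_forward \<psi>_def
          by (simp add: norm_mult mult_left_mono)
        then show ?thesis
          using nz by (simp add: field_simps)
      qed
      then show "\<forall>\<^sub>F k in sequentially. cmod (Psi \<phi> lam (n k) (cnj lam ^ j * z1)) \<le> cmod (Psi \<phi> lam (n k) z1) * (C ^ j / cmod (Psi \<phi> lam j z1))"
        by simp
      show "(\<lambda>k. cmod (Psi \<phi> lam (n k) z1) * (C ^ j / cmod (Psi \<phi> lam j z1))) \<longlonglongrightarrow> 0"
        by (intro tendsto_mult_left_zero tendsto_norm_zero upper)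
    qed
    then show thesis
      using lam not_root(2) by (intro that[of "cnj lam"]) auto
  qed
  have orbit: "\<kappa> ^ j * z1 \<in> ball 0 1" for j
    using z1 \<kappa>(1) by (simp add: norm_mult norm_power)
  define \<mu> where "\<mu> j = \<phi> 0 * lam ^ j" for j
  have \<mu>_ge: "cmod (\<mu> j) \<ge> 1" for j
    using large lam by (simp add: \<mu>_def norm_mult norm_power)
  have inj: "inj \<mu>"
  proof (rule linorder_injI)
    fix i j :: nat assume "i < j"
    then have "lam ^ j = lam ^ i * lam ^ (j - i)"
      by (simp flip: power_add)
    moreover have "lam \<noteq> 0" "\<phi> 0 \<noteq> 0"
      using lam large by auto
    ultimately show "\<mu> i \<noteq> \<mu> j"
      using not_root(1)[of "j - i"] \<open>i < j\<close> by (simp add: \<mu>_def)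
  qed
  have eigen: "\<exists>p. \<forall>j<N. T (p j) = scaleH (\<mu> j) (p j) \<and> hcoeff (p j) j = 1 \<and> (\<forall>n>j. hcoeff (p j) n = 0)" for N
  proof (rule triangular_eigenvectors[OF bT _ _ inj])
    show "hcoeff (T (monomial j)) j = \<mu> j" for j
      unfolding \<mu>_def by (rule hcoeff_rot_shift_monomial_diag[OF lam phi T])
    show "hcoeff (T (monomial j)) i = 0" if "j < i" for i j
      using that by (simp add: hcoeff_rot_shift_monomial[OF lam phi T])
  qed
  show ?thesis
  proof (rule hypercyclic_by_generators[OF bT, where m = "\<lambda>J. n"
        and F = "kernel ` range (\<lambda>j. \<kappa> ^ j * z1)" and E = "{p. \<exists>j. T p = scaleH (\<mu> j) p}"])
    fix u assume "u \<in> kernel ` range (\<lambda>j. \<kappa> ^ j * z1)"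
    then obtain j where u: "u = kernel (\<kappa> ^ j * z1)" by blast
    have "(\<lambda>k. norm ((T ^^ n k) u)) \<longlonglongrightarrow> 0"
      unfolding u norm_kernelT[OF orbit] by (intro tendsto_mult_left_zero tendsto_norm_zero decay)
    then show "(\<lambda>k. (T ^^ n k) u) \<longlonglongrightarrow> 0"
      by (rule tendsto_norm_zero_cancel)
  next
    fix g assume orth: "hinner u g = 0" if "u \<in> kernel ` range (\<lambda>j. \<kappa> ^ j * z1)" for u
    obtain \<xi> where "\<xi> \<in> ball 0 1" "\<xi> islimpt range (\<lambda>j. \<kappa> ^ j * z1)"
      using rotation_orbit_islimpt[OF \<kappa> z1_nz z1] by blast
    then show "g = 0"
      using orth orbit by (intro kernels_total[of "range (\<lambda>j. \<kappa> ^ j * z1)" \<xi> g]) auto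
  next
    fix g assume orth: "hinner e g = 0" if "e \<in> {p. \<exists>j. T p = scaleH (\<mu> j) p}" for e
    show "g = 0"
    proof (rule hardy_coeff_eqI)
      fix i
      obtain p where p: "\<And>j. j < Suc i \<Longrightarrow> T (p j) = scaleH (\<mu> j) (p j)"
          "\<And>j. j < Suc i \<Longrightarrow> hcoeff (p j) j = 1 \<and> (\<forall>n>j. hcoeff (p j) n = 0)"
        using eigen[of "Suc i"] by blast
      \<comment> \<open>Each monomial is a combination of eigenvectors, so orthogonality to all
        eigenvectors kills every coefficient of \<open>g\<close>.\<close>
      obtain b where b: "monomial i = (\<Sum>j<Suc i. scaleH (b j) (p j))"
        using triangular_basis_span[of "Suc i" p "monomial i"] p(2) by (auto simp: hcoeff_monomial)
      have "hinner (monomial i) g = (\<Sum>j<Suc i. b j * hinner (p j) g)"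
        unfolding b by (simp only: hinner_sum_left hinner_scaleH_left)
      also have "\<dots> = 0"
        using orth p(1) by (intro sum.neutral) auto
      finally show "hcoeff g i = hcoeff 0 i"
        by (simp add: hinner_monomial_left)
    qed
  next
    fix e assume "e \<in> {p. \<exists>j. T p = scaleH (\<mu> j) p}"
    then obtain j where e: "T e = scaleH (\<mu> j) e" by blast
    have pow: "(T ^^ m) e = scaleH (\<mu> j ^ m) e" for m
    proof (induction m)
      case 0
      show ?case by (rule hardy_eqI) simp
    next
      case (Suc m)
      then show ?case
        by (auto intro!: hardy_eqI simp: bounded_operatorD(2)[OF bT] e)
    qed
    have \<mu>0: "\<mu> j \<noteq> 0"
      using \<mu>_ge[of j] by auto
    have "(T ^^ m) (scaleH (inverse (\<mu> j ^ m)) e) = e" for m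
      unfolding bounded_operator_funpow_scaleH[OF bT] pow using \<mu>0 by (intro hardy_eqI) simp
    \<comment> \<open>Eigenvalues of modulus at least 1 keep the inverse powers in the closed unit
      disc, whose image on the line through \<open>e\<close> is compact.\<close>
    moreover have "scaleH (inverse (\<mu> j ^ m)) e \<in> (\<lambda>a. scaleH a e) ` cball 0 1" for m
      using \<mu>_ge[of j] by (intro imageI) (simp add: norm_inverse norm_power inverse_le_1_iff one_le_power)
    moreover have "compact ((\<lambda>a. scaleH a e) ` cball 0 1)"
      by (intro compact_continuous_image linear_continuous_on bounded_linear_scaleH_left compact_cball)
    ultimately have "\<exists>K x. compact K \<and> (\<forall>k. x k \<in> K \<and> (T ^^ n k) (x k) = e)"
      by (intro exI conjI allI)
    then show "\<exists>J0. \<forall>J\<ge>J0. \<exists>K x. compact K \<and> (\<forall>k. x k \<in> K \<and> (T ^^ n k) (x k) = e)"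
      by blast
  qed
qed

theorem theorem4p11:
  fixes lam :: complex and \<phi> :: "complex \<Rightarrow> complex" and T :: "hardy \<Rightarrow> hardy"
    and n :: "nat \<Rightarrow> nat" and z0 z1 :: complex and c :: real
  assumes "lam \<in> sphere 0 1" and "irrational_rotation lam"
    and "\<phi> \<in> Hinfty" and "\<exists>z\<in>ball 0 1. \<phi> z \<noteq> 0"
    and "T = rot_op lam \<circ> shift_op \<phi>"
    and "strict_mono n" and "\<And>k. n k > 0"
    and "z0 \<in> ball 0 1" and "c > 0" and "\<And>k. cmod (Omega \<phi> lam (n k) z0) > c"
    and "z1 \<in> ball 0 1" and "(\<lambda>k. Psi \<phi> lam (n k) z1) \<longlonglongrightarrow> 0"
  shows "hypercyclic T"
proof (cases "cmod (\<phi> 0) < 1")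
  case True
  then show ?thesis
    using assms by (intro hypercyclic_if_contractive_at_0[of lam \<phi> T n z0 c]) simp_all
next
  case False
  then show ?thesis
    using assms by (intro hypercyclic_if_expansive_at_0[of lam \<phi> T n z1]) simp_all
qed

end
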